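(* Let $J\subset\mathbb{N}$ be a finite subset, $\omega=(\omega_n)_{n\in\mathbb{N}}$ a frequency, and $(G,\beta)$ an $\omega$-Dirichlet group with normalized Haar measure $\mathrm{m}$. Then $$\boldsymbol{\lambda}\big(\mathcal{H}_\infty^{J}(\omega)\big)=\int_G\Big|\sum_{n\in J}h_{\omega_n}\Big|\,d\mathrm{m}.$$
   Context: A frequency is a strictly increasing, non-negative real sequence $\omega=(\omega_n)_{n\in\mathbb{N}}$ with $\omega_n\to\infty$. For a finite set $J\subset\mathbb{N}$, $\mathcal{H}_\infty^J(\omega)$ is the finite dimensional complex Banach space of all $\omega$-Dirichlet polynomials $D(s)=\sum_{n\in J}a_n e^{-\omega_n s}$, $s\in\mathbb{C}$, with $a_n\in\mathbb{C}$, endowed with the norm $\|D\|_\infty=\sup_{t\in\mathbb{R}}\big|\sum_{n\in J}a_n e^{-i\omega_n t}\big|$. A Dirichlet group is a pair $(G,\beta)$ where $G$ is a compact abelian group and $\beta\colon(\mathbb{R},+)\to G$ is a continuous homomorphism with dense range. It is an $\omega$-Dirichlet group if for every $n\in\mathbb{N}$ there is a (necessarily unique) continuous character $h_{\omega_n}\in\widehat{G}$ with $h_{\omega_n}\circ\beta(t)=e^{-i\omega_n t}$ for all $t\in\mathbb{R}$. For a closed subspace $X$ of a complex Banach space $Y$, the relative projection constant is $\boldsymbol{\lambda}(X,Y)=\inf\{\|P\|: P\colon Y\to X \text{ bounded linear},\ P|_X=\mathrm{id}_X\}$ (with $\inf\emptyset=\infty$). The (absolute) projection constant of a finite dimensional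 Banach space $X$ is $\boldsymbol{\lambda}(X)=\sup\boldsymbol{\lambda}(I(X),Y)$, the supremum being over all Banach spaces $Y$ and isometric linear embeddings $I\colon X\to Y$ with $I(X)$ complemented in $Y$. *)

theory Defs
  imports "HOL-Analysis.Analysis" "HOL-Algebra.Module"
begin

section \<open>Complex Banach spaces with explicit carrier\<close>

text \<open>
  The projection constant involves a supremum over all Banach spaces containing a given one, so
  Banach spaces have to be objects one can quantify over. They are modules of HOL-Algebra over the
  field of complex numbers, with an additional norm. The fields \<open>mult\<close> and \<open>one\<close>, which the
  record type of modules inherits from rings, carry no information.
\<close>

definition complex_ring :: "complex ring" where
  "complex_ring = \<lparr>carrier = UNIV, mult = (*), one = 1, zero = 0, add = (+)\<rparr>"

record 'y normed_module = "(complex, 'y) module" +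
  nrm :: "'y \<Rightarrow> real"

locale complex_normed_space =
  Module.module complex_ring Y for Y :: "'y normed_module" +
  assumes nrm_nonneg: "x \<in> carrier Y \<Longrightarrow> 0 \<le> nrm Y x"
    and nrm_eq_0_iff: "x \<in> carrier Y \<Longrightarrow> nrm Y x = 0 \<longleftrightarrow> x = \<zero>\<^bsub>Y\<^esub>"
    and nrm_smult: "x \<in> carrier Y \<Longrightarrow> nrm Y (c \<odot>\<^bsub>Y\<^esub> x) = cmod c * nrm Y x"
    and nrm_triangle: "x \<in> carrier Y \<Longrightarrow> y \<in> carrier Y \<Longrightarrow> nrm Y (x \<oplus>\<^bsub>Y\<^esub> y) \<le> nrm Y x + nrm Y y"

locale complex_banach_space = complex_normed_space Y for Y :: "'y normed_module" +
  assumes complete: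
    "(\<And>n. \<sigma> n \<in> carrier Y) \<Longrightarrow>
     (\<And>e. e > 0 \<Longrightarrow> \<exists>N. \<forall>m\<ge>N. \<forall>n\<ge>N. nrm Y (\<sigma> m \<ominus>\<^bsub>Y\<^esub> \<sigma> n) < e) \<Longrightarrow>
     \<exists>l\<in>carrier Y. (\<lambda>n. nrm Y (\<sigma> n \<ominus>\<^bsub>Y\<^esub> l)) \<longlonglongrightarrow> 0"

definition linear_map :: "'y normed_module \<Rightarrow> 'z normed_module \<Rightarrow> ('y \<Rightarrow> 'z) \<Rightarrow> bool" where
  "linear_map Y Z T \<longleftrightarrow>
     T \<in> carrier Y \<rightarrow> carrier Z \<and>
     (\<forall>x\<in>carrier Y. \<forall>y\<in>carrier Y. T (x \<oplus>\<^bsub>Y\<^esub> y) = T x \<oplus>\<^bsub>Z\<^esub> T y) \<and>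
     (\<forall>c. \<forall>x\<in>carrier Y. T (c \<odot>\<^bsub>Y\<^esub> x) = c \<odot>\<^bsub>Z\<^esub> T x)"

definition bounded_linear_map :: "'y normed_module \<Rightarrow> 'z normed_module \<Rightarrow> ('y \<Rightarrow> 'z) \<Rightarrow> bool" where
  "bounded_linear_map Y Z T \<longleftrightarrow>
     linear_map Y Z T \<and> (\<exists>C. \<forall>y\<in>carrier Y. nrm Z (T y) \<le> C * nrm Y y)"

definition op_norm :: "'y normed_module \<Rightarrow> 'z normed_module \<Rightarrow> ('y \<Rightarrow> 'z) \<Rightarrow> ennreal" where
  "op_norm Y Z T = (SUP y\<in>{y \<in> carrier Y. nrm Y y \<le> 1}. ennreal (nrm Z (T y)))"

definition isometric_embedding :: "'x normed_module \<Rightarrow> 'y normed_module \<Rightarrow> ('x \<Rightarrow> 'y) \<Rightarrow> bool" where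
  "isometric_embedding X Y I \<longleftrightarrow>
     linear_map X Y I \<and> (\<forall>x\<in>carrier X. nrm Y (I x) = nrm X x)"


section \<open>Projection constants\<close>

definition is_projection :: "'y set \<Rightarrow> 'y normed_module \<Rightarrow> ('y \<Rightarrow> 'y) \<Rightarrow> bool" where
  "is_projection U Y P \<longleftrightarrow>
     bounded_linear_map Y Y P \<and> P ` carrier Y \<subseteq> U \<and> (\<forall>x\<in>U. P x = x)"

definition complemented :: "'y set \<Rightarrow> 'y normed_module \<Rightarrow> bool" where
  "complemented U Y \<longleftrightarrow> (\<exists>P. is_projection U Y P)"

text \<open>The infimum of the empty set is \<open>\<infinity>\<close> in \<^typ>\<open>ennreal\<close>.\<close>

definition relative_projection_constant :: "'y set \<Rightarrow> 'y normed_module \<Rightarrow> ennreal" where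
  "relative_projection_constant U Y = (INF P\<in>{P. is_projection U Y P}. op_norm Y Y P)"

text \<open>
  A single HOL term cannot range over the Banach spaces on all types. Here the superspaces \<open>Y\<close>
  range over all Banach spaces whose carrier is contained in the type \<^typ>\<open>'x + 'y\<close>, where \<open>'x\<close> is
  the type containing the carrier of the given space \<open>X\<close> and the type \<open>'y\<close> is arbitrary.
  A statement about \<open>projection_constant TYPE('y) X\<close> with a free type variable \<open>'y\<close> therefore
  covers every Banach space \<open>Y\<close>, whatever its cardinality, while the summand \<open>'x\<close> makes sure that
  there is always enough room: for a nonzero finite dimensional \<open>X\<close> it has at least the cardinality
  of the continuum, so a copy of the space of bounded sequences, into which \<open>X\<close> embeds
  isometrically and where the supremum is attained, is among the \<open>Y\<close>.
\<close>

definition projection_constant :: "'y itself \<Rightarrow> 'x normed_module \<Rightarrow> ennreal" where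
  "projection_constant _ X =
     (SUP (Y, I)\<in>{(Y :: ('x + 'y) normed_module, I :: 'x \<Rightarrow> 'x + 'y).
                    complex_banach_space Y \<and> isometric_embedding X Y I \<and>
                    complemented (I ` carrier X) Y}.
        relative_projection_constant (I ` carrier X) Y)"


section \<open>Dirichlet polynomials\<close>

definition frequency :: "(nat \<Rightarrow> real) \<Rightarrow> bool" where
  "frequency \<omega> \<longleftrightarrow> strict_mono \<omega> \<and> (\<forall>n. 0 \<le> \<omega> n) \<and> filterlim \<omega> at_top sequentially"

definition dirichlet_polynomials :: "nat set \<Rightarrow> (nat \<Rightarrow> real) \<Rightarrow> (complex \<Rightarrow> complex) normed_module" where
  "dirichlet_polynomials J \<omega> =
     \<lparr>carrier = {D. \<exists>a :: nat \<Rightarrow> complex. D = (\<lambda>s. \<Sum>n\<in>J. a n * exp (- of_real (\<omega> n) * s))},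
      mult = (\<lambda>D E s. D s * E s),
      one = (\<lambda>s. 1),
      zero = (\<lambda>s. 0),
      add = (\<lambda>D E s. D s + E s),
      smult = (\<lambda>c D s. c * D s),
      nrm = (\<lambda>D. SUP t :: real. cmod (D (\<i> * of_real t)))\<rparr>"


section \<open>Dirichlet groups\<close>

text \<open>
  Abelian groups are written additively; compact groups are Hausdorff, as usual.
\<close>

definition dirichlet_group :: "(real \<Rightarrow> 'g :: {topological_ab_group_add, t2_space}) \<Rightarrow> bool" where
  "dirichlet_group \<beta> \<longleftrightarrow>
     compact (UNIV :: 'g set) \<and>
     continuous_on UNIV \<beta> \<and> (\<forall>s t. \<beta> (s + t) = \<beta> s + \<beta> t) \<and> closure (range \<beta>) = UNIV"

definition continuous_character :: "('g :: {topological_ab_group_add, t2_space} \<Rightarrow> complex) \<Rightarrow> bool" where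
  "continuous_character h \<longleftrightarrow>
     continuous_on UNIV h \<and> (\<forall>x. cmod (h x) = 1) \<and> (\<forall>x y. h (x + y) = h x * h y)"

definition represents_frequency ::
  "(real \<Rightarrow> 'g :: {topological_ab_group_add, t2_space}) \<Rightarrow> real \<Rightarrow> ('g \<Rightarrow> complex) \<Rightarrow> bool" where
  "represents_frequency \<beta> x h \<longleftrightarrow>
     continuous_character h \<and> (\<forall>t. h (\<beta> t) = exp (- (\<i> * of_real x * of_real t)))"

definition omega_dirichlet_group ::
  "(nat \<Rightarrow> real) \<Rightarrow> (real \<Rightarrow> 'g :: {topological_ab_group_add, t2_space}) \<Rightarrow> bool" where
  "omega_dirichlet_group \<omega> \<beta> \<longleftrightarrow>
     dirichlet_group \<beta> \<and> (\<forall>n. \<exists>h. represents_frequency \<beta> (\<omega> n) h)"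

text \<open>By density of the range of \<open>\<beta>\<close> there is at most one such character.\<close>

definition frequency_character :: "(real \<Rightarrow> 'g :: {topological_ab_group_add, t2_space}) \<Rightarrow> real \<Rightarrow> 'g \<Rightarrow> complex" where
  "frequency_character \<beta> x = (THE h. represents_frequency \<beta> x h)"

text \<open>
  On a compact group the normalized Haar measure is the unique translation invariant regular Borel
  probability measure.
\<close>

definition normalized_haar_measure :: "('g :: {topological_ab_group_add, t2_space}) measure \<Rightarrow> bool" where
  "normalized_haar_measure m \<longleftrightarrow>
     sets m = sets borel \<and> emeasure m UNIV = 1 \<and>
     (\<forall>g. \<forall>A\<in>sets m. emeasure m ((+) g ` A) = emeasure m A) \<and>
     (\<forall>A\<in>sets m. emeasure m A = (INF U\<in>{U. open U \<and> A \<subseteq> U}. emeasure m U)) \<and>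
     (\<forall>U. open U \<longrightarrow> emeasure m U = (SUP K\<in>{K. compact K \<and> K \<subseteq> U}. emeasure m K))"

end

theory Submission
  imports Defs
begin

text \<open>
  Write \<open>D\<close> for the sum of the characters \<open>h n\<close> with \<open>n \<in> J\<close>, and \<open>X\<close> for the space of Dirichlet
  polynomials. Since the range of \<open>\<beta>\<close> is dense, restricting to the imaginary axis identifies \<open>X\<close>
  isometrically with the span of the \<open>h n\<close> in \<open>C(G)\<close>, where \<open>f(x) = \<integral> f(z) D(x - z) dm(z)\<close>. So
  convolution with \<open>D\<close> projects \<open>C(G)\<close> onto \<open>X\<close> with norm at most \<open>\<parallel>D\<parallel>\<^sub>1\<close>. It remains to
  see that every Banach space containing \<open>X\<close> admits a projection this good, and that in some
  superspace nothing better exists.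

  For the upper bound, let \<open>I\<close> embed \<open>X\<close> isometrically into \<open>Y\<close>. A linear map from \<open>Y\<close> to \<open>X\<close> amounts
  to a linear functional \<open>\<Phi>\<close> on sequences \<open>v\<close> in \<open>Y\<close> indexed by \<open>J\<close>, and it inverts \<open>I\<close> if and only if,
  on sequences in \<open>I X\<close>, \<open>\<Phi>\<close> is the trace: the sum over \<open>n\<close> of the \<open>n\<close>-th coefficient of the \<open>n\<close>-th
  polynomial. The seminorm \<open>\<integral> \<parallel>\<Sum>n\<in>J. cnj (h n z) v n\<parallel> dm(z)\<close>
  dominates the trace by orthonormality of the \<open>h n\<close> (\<open>trace_le_averaged_seminorm\<close>), and on the
  sequences \<open>(h n x y)\<^sub>n\<close> that compute the value at \<open>x\<close> of the image of \<open>y\<close> it equals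
  \<open>\<parallel>D\<parallel>\<^sub>1 \<parallel>y\<parallel>\<close> (\<open>averaged_seminorm_point\<close>). A Hahn--Banach extension of the trace
  (\<open>complex_hahn_banach\<close>) is therefore a projection of norm at most \<open>\<parallel>D\<parallel>\<^sub>1\<close>
  (\<open>projection_exists\<close>). Averaging the norm instead of the functionals avoids integrating a choice of
  functionals on \<open>Y\<close> over \<open>G\<close>, which need not be measurable.

  For the lower bound, let \<open>P\<close> be a projection onto \<open>X\<close> in the space of bounded continuous functions.
  Averaging \<open>P\<close> over translations by elements of the group yields convolution with \<open>D\<close> on
  trigonometric polynomials, pulled back by \<open>\<beta>\<close>, and does not increase the norm (\<open>projection_translation_average\<close>).
  Evaluated at the origin this says \<open>\<bar>\<integral> F cnj D dm\<bar> \<le> \<parallel>P\<parallel>\<close> for trigonometric polynomials \<open>F\<close> bounded by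
  \<open>1\<close>, and such \<open>F\<close> approximate the sign of \<open>D\<close> well enough to make the left-hand side tend to
  \<open>\<parallel>D\<parallel>\<^sub>1\<close> (\<open>kernel_sign_approximation\<close>).
\<close>

section \<open>Complex modules\<close>

lemma complex_ring_simps [simp]:
  "carrier complex_ring = UNIV" "mult complex_ring = (*)" "one complex_ring = 1"
  "zero complex_ring = 0" "add complex_ring = (+)"
  by (simp_all add: complex_ring_def)

lemma complex_ring_cring: "cring complex_ring"
proof (rule cringI)
  show "abelian_group complex_ring"
  proof (rule abelian_groupI)
    show "\<exists>y\<in>carrier complex_ring. y \<oplus>\<^bsub>complex_ring\<^esub> x = \<zero>\<^bsub>complex_ring\<^esub>" for x
      by (auto intro: exI [of _ "- x"])
  qed (auto simp: algebra_simps)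
  show "comm_monoid complex_ring"
    by (rule comm_monoidI) (auto simp: algebra_simps)
qed (auto simp: algebra_simps)

locale complex_module = Module.module complex_ring M for M :: "(complex, 'v, 'b) module_scheme" (structure)
begin

lemma smult_in [simp, intro]: "x \<in> carrier M \<Longrightarrow> c \<odot>\<^bsub>M\<^esub> x \<in> carrier M"
  using smult_closed by simp

lemma smult_add_left: "x \<in> carrier M \<Longrightarrow> (a + b) \<odot>\<^bsub>M\<^esub> x = a \<odot>\<^bsub>M\<^esub> x \<oplus>\<^bsub>M\<^esub> b \<odot>\<^bsub>M\<^esub> x"
  using smult_l_distr [of a b x] by simp

lemma smult_add_right:
  "x \<in> carrier M \<Longrightarrow> y \<in> carrier M \<Longrightarrow> a \<odot>\<^bsub>M\<^esub> (x \<oplus>\<^bsub>M\<^esub> y) = a \<odot>\<^bsub>M\<^esub> x \<oplus>\<^bsub>M\<^esub> a \<odot>\<^bsub>M\<^esub> y"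
  using smult_r_distr [of a x y] by simp

lemma smult_smult: "x \<in> carrier M \<Longrightarrow> a \<odot>\<^bsub>M\<^esub> (b \<odot>\<^bsub>M\<^esub> x) = (a * b) \<odot>\<^bsub>M\<^esub> x"
  using smult_assoc1 [of a b x] by simp

lemma smult_1 [simp]: "x \<in> carrier M \<Longrightarrow> 1 \<odot>\<^bsub>M\<^esub> x = x"
  using smult_one [of x] by simp

lemma smult_0 [simp]: "x \<in> carrier M \<Longrightarrow> 0 \<odot>\<^bsub>M\<^esub> x = \<zero>\<^bsub>M\<^esub>"
  using smult_l_null [of x] by simp

lemma smult_zero [simp]: "c \<odot>\<^bsub>M\<^esub> \<zero>\<^bsub>M\<^esub> = \<zero>\<^bsub>M\<^esub>"
  using smult_r_null [of c] by simp

lemma minus_eq_smult: "x \<in> carrier M \<Longrightarrow> \<ominus>\<^bsub>M\<^esub> x = (-1) \<odot>\<^bsub>M\<^esub> x"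
proof (rule minus_equality)
  assume x: "x \<in> carrier M"
  have "(-1) \<odot>\<^bsub>M\<^esub> x \<oplus>\<^bsub>M\<^esub> x = (-1 + 1) \<odot>\<^bsub>M\<^esub> x"
    using x by (simp only: smult_add_left smult_1)
  then show "(-1) \<odot>\<^bsub>M\<^esub> x \<oplus>\<^bsub>M\<^esub> x = \<zero>\<^bsub>M\<^esub>" using x by simp
qed auto

lemma finsum_smult:
  "finite A \<Longrightarrow> f \<in> A \<rightarrow> carrier M \<Longrightarrow> c \<odot>\<^bsub>M\<^esub> (\<Oplus>\<^bsub>M\<^esub>i\<in>A. f i) = (\<Oplus>\<^bsub>M\<^esub>i\<in>A. c \<odot>\<^bsub>M\<^esub> f i)"
  using finsum_smult_ldistr [of A c f] by simp

lemma finsum_smult_left: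
  "finite A \<Longrightarrow> x \<in> carrier M \<Longrightarrow> (\<Oplus>\<^bsub>M\<^esub>i\<in>A. c i \<odot>\<^bsub>M\<^esub> x) = (\<Sum>i\<in>A. c i) \<odot>\<^bsub>M\<^esub> x"
  by (induction rule: finite_induct) (simp_all add: finsum_insert smult_add_left)

end

section \<open>The Hahn--Banach theorem\<close>

text \<open>
  A real linear functional on a real subspace, dominated by \<open>p\<close>, is encoded by its graph: a real
  subspace of \<open>M \<times> \<real>\<close> on which the second component is at most \<open>p\<close> of the first. Such a subspace is
  automatically single-valued, because the values at \<open>0\<close> form a subspace of \<open>\<real>\<close> bounded above by
  \<open>p 0 = 0\<close>. Extension of functionals becomes inclusion of sets, and unions of chains cause no trouble.
\<close>

definition dominated_graph ::
    "(complex, 'v, 'b) module_scheme \<Rightarrow> ('v \<Rightarrow> real) \<Rightarrow> ('v \<times> real) set \<Rightarrow> bool" where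
  "dominated_graph M p H \<longleftrightarrow>
     (\<zero>\<^bsub>M\<^esub>, 0) \<in> H \<and>
     (\<forall>v a. (v, a) \<in> H \<longrightarrow> v \<in> carrier M \<and> a \<le> p v) \<and>
     (\<forall>v a w b. (v, a) \<in> H \<longrightarrow> (w, b) \<in> H \<longrightarrow> (v \<oplus>\<^bsub>M\<^esub> w, a + b) \<in> H) \<and>
     (\<forall>v a r. (v, a) \<in> H \<longrightarrow> (of_real r \<odot>\<^bsub>M\<^esub> v, r * a) \<in> H)"

locale seminormed_module = complex_module M for M :: "(complex, 'v, 'b) module_scheme" (structure) +
  fixes p :: "'v \<Rightarrow> real"
  assumes p_triangle: "x \<in> carrier M \<Longrightarrow> y \<in> carrier M \<Longrightarrow> p (x \<oplus>\<^bsub>M\<^esub> y) \<le> p x + p y"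
    and p_smult: "x \<in> carrier M \<Longrightarrow> p (c \<odot>\<^bsub>M\<^esub> x) = cmod c * p x"
begin

lemma p_zero: "p \<zero>\<^bsub>M\<^esub> = 0"
  using p_smult [of "\<zero>\<^bsub>M\<^esub>" 0] by simp

text \<open>
  The one-dimensional extension step. A value \<open>c\<close> at \<open>u\<close> is admissible as soon as
  \<open>b - p (w - u) \<le> c \<le> p (w + u) - b\<close> for all \<open>(w, b)\<close> in the graph, since all other multiples of \<open>u\<close>
  reduce to \<open>\<plusminus>u\<close> by homogeneity; the triangle inequality puts every left-hand side below every
  right-hand side.
\<close>

lemma dominated_graph_extend:
  assumes H: "dominated_graph M p H" and u: "u \<in> carrier M"
  shows "\<exists>H' c. dominated_graph M p H' \<and> H \<subseteq> H' \<and> (u, c) \<in> H'"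
proof -
  have H0: "(\<zero>\<^bsub>M\<^esub>, 0) \<in> H"
    and Hc: "(v, a) \<in> H \<Longrightarrow> v \<in> carrier M" and Hp: "(v, a) \<in> H \<Longrightarrow> a \<le> p v"
    and Ha: "(v, a) \<in> H \<Longrightarrow> (w, b) \<in> H \<Longrightarrow> (v \<oplus>\<^bsub>M\<^esub> w, a + b) \<in> H"
    and Hs: "(v, a) \<in> H \<Longrightarrow> (of_real r \<odot>\<^bsub>M\<^esub> v, r * a) \<in> H" for v w a b r
    using H unfolding dominated_graph_def by blast+
  define lo where "lo = (\<lambda>(w, b). b - p (w \<oplus>\<^bsub>M\<^esub> (-1) \<odot>\<^bsub>M\<^esub> u))"
  define hi where "hi = (\<lambda>(w, b). p (w \<oplus>\<^bsub>M\<^esub> u) - b)"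
  have lohi: "lo x \<le> hi y" if "x \<in> H" "y \<in> H" for x y
  proof -
    obtain w a v b where xy: "x = (w, a)" "y = (v, b)" by fastforce
    have w: "w \<in> carrier M" and v: "v \<in> carrier M" using that xy Hc by auto
    have "a + b \<le> p (w \<oplus>\<^bsub>M\<^esub> v)" using Hp [OF Ha] that xy by blast
    also have "w \<oplus>\<^bsub>M\<^esub> v = (w \<oplus>\<^bsub>M\<^esub> (-1) \<odot>\<^bsub>M\<^esub> u) \<oplus>\<^bsub>M\<^esub> (v \<oplus>\<^bsub>M\<^esub> u)"
    proof -
      have "(w \<oplus>\<^bsub>M\<^esub> (-1) \<odot>\<^bsub>M\<^esub> u) \<oplus>\<^bsub>M\<^esub> (v \<oplus>\<^bsub>M\<^esub> u) = (w \<oplus>\<^bsub>M\<^esub> v) \<oplus>\<^bsub>M\<^esub> ((-1) \<odot>\<^bsub>M\<^esub> u \<oplus>\<^bsub>M\<^esub> u)"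
        using w v u by (simp add: a_ac)
      also have "(-1) \<odot>\<^bsub>M\<^esub> u \<oplus>\<^bsub>M\<^esub> u = \<zero>\<^bsub>M\<^esub>"
        using u minus_eq_smult [OF u] l_neg [OF u] by simp
      finally show ?thesis using w v by simp
    qed
    also have "p \<dots> \<le> p (w \<oplus>\<^bsub>M\<^esub> (-1) \<odot>\<^bsub>M\<^esub> u) + p (v \<oplus>\<^bsub>M\<^esub> u)"
      using w v u by (intro p_triangle) auto
    finally show ?thesis by (simp add: xy lo_def hi_def)
  qed
  define c where "c = Sup (lo ` H)"
  have bdd: "bdd_above (lo ` H)" using lohi [OF _ H0] by (intro bdd_aboveI2)
  have lo: "lo x \<le> c" if "x \<in> H" for x
    unfolding c_def using that bdd by (intro cSup_upper) auto
  have hi: "c \<le> hi y" if "y \<in> H" for y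
    unfolding c_def
  proof (rule cSup_least)
    show "lo ` H \<noteq> {}" using H0 by blast
  qed (use that lohi in blast)
  define H' where "H' = {(w \<oplus>\<^bsub>M\<^esub> of_real r \<odot>\<^bsub>M\<^esub> u, b + r * c) | w b r. (w, b) \<in> H}"
  have H'I: "(w \<oplus>\<^bsub>M\<^esub> of_real r \<odot>\<^bsub>M\<^esub> u, b + r * c) \<in> H'" if "(w, b) \<in> H" for w b r
    using that unfolding H'_def by blast
  have dom: "b + r * c \<le> p (w \<oplus>\<^bsub>M\<^esub> of_real r \<odot>\<^bsub>M\<^esub> u)" if wb: "(w, b) \<in> H" for w b r
  proof -
    have w: "w \<in> carrier M" using Hc wb .
    have scale: "p (w \<oplus>\<^bsub>M\<^esub> of_real (s * e) \<odot>\<^bsub>M\<^esub> u)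
        = s * p (of_real (1 / s) \<odot>\<^bsub>M\<^esub> w \<oplus>\<^bsub>M\<^esub> of_real e \<odot>\<^bsub>M\<^esub> u)" if "s > 0" for s e :: real
    proof -
      have "w \<oplus>\<^bsub>M\<^esub> of_real (s * e) \<odot>\<^bsub>M\<^esub> u
          = of_real s \<odot>\<^bsub>M\<^esub> (of_real (1 / s) \<odot>\<^bsub>M\<^esub> w \<oplus>\<^bsub>M\<^esub> of_real e \<odot>\<^bsub>M\<^esub> u)"
        using w u that by (simp add: smult_add_right smult_smult)
      also have "p \<dots> = s * p (of_real (1 / s) \<odot>\<^bsub>M\<^esub> w \<oplus>\<^bsub>M\<^esub> of_real e \<odot>\<^bsub>M\<^esub> u)"
        using w u that by (subst p_smult) auto
      finally show ?thesis .
    qed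
    consider "r = 0" | "r > 0" | "r < 0" by linarith
    then show ?thesis
    proof cases
      case 1
      then show ?thesis using w u Hp [OF wb] by simp
    next
      case 2
      have "c \<le> p (of_real (1 / r) \<odot>\<^bsub>M\<^esub> w \<oplus>\<^bsub>M\<^esub> u) - 1 / r * b"
        using hi [OF Hs [OF wb, of "1 / r"]] by (simp add: hi_def)
      then have "r * c \<le> r * (p (of_real (1 / r) \<odot>\<^bsub>M\<^esub> w \<oplus>\<^bsub>M\<^esub> u) - 1 / r * b)"
        using 2 by (intro mult_left_mono) auto
      then show ?thesis using scale [of r 1] 2 u by (simp add: algebra_simps)
    next
      case 3
      define s where "s = - r"
      have s: "s > 0" "r = - s" using 3 by (auto simp: s_def)
      have "1 / s * b - p (of_real (1 / s) \<odot>\<^bsub>M\<^esub> w \<oplus>\<^bsub>M\<^esub> (-1) \<odot>\<^bsub>M\<^esub> u) \<le> c"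
        using lo [OF Hs [OF wb, of "1 / s"]] by (simp add: lo_def)
      then have "s * (1 / s * b - p (of_real (1 / s) \<odot>\<^bsub>M\<^esub> w \<oplus>\<^bsub>M\<^esub> (-1) \<odot>\<^bsub>M\<^esub> u)) \<le> s * c"
        using s by (intro mult_left_mono) auto
      then show ?thesis using scale [of s "-1"] s u by (simp add: algebra_simps)
    qed
  qed
  have "dominated_graph M p H'"
    unfolding dominated_graph_def
  proof (intro conjI allI impI)
    show "(\<zero>\<^bsub>M\<^esub>, 0) \<in> H'"
      using H'I [OF H0, of 0] u by simp
  next
    fix v a assume "(v, a) \<in> H'"
    then obtain w b r where *: "v = w \<oplus>\<^bsub>M\<^esub> of_real r \<odot>\<^bsub>M\<^esub> u" "a = b + r * c" "(w, b) \<in> H"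
      unfolding H'_def by blast
    then show "v \<in> carrier M" "a \<le> p v" using u Hc dom by auto
  next
    fix v a v' a' assume "(v, a) \<in> H'" "(v', a') \<in> H'"
    then obtain w b r w' b' r' where *: "v = w \<oplus>\<^bsub>M\<^esub> of_real r \<odot>\<^bsub>M\<^esub> u" "a = b + r * c" "(w, b) \<in> H"
      "v' = w' \<oplus>\<^bsub>M\<^esub> of_real r' \<odot>\<^bsub>M\<^esub> u" "a' = b' + r' * c" "(w', b') \<in> H"
      unfolding H'_def by blast
    have "v \<oplus>\<^bsub>M\<^esub> v' = (w \<oplus>\<^bsub>M\<^esub> w') \<oplus>\<^bsub>M\<^esub> of_real (r + r') \<odot>\<^bsub>M\<^esub> u"
      using * u Hc by (simp add: smult_add_left a_ac)
    moreover have "a + a' = (b + b') + (r + r') * c" using * by (simp add: algebra_simps)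
    ultimately show "(v \<oplus>\<^bsub>M\<^esub> v', a + a') \<in> H'"
      by (simp only: H'I [OF Ha [OF *(3) *(6)]])
  next
    fix v a and t :: real assume "(v, a) \<in> H'"
    then obtain w b r where *: "v = w \<oplus>\<^bsub>M\<^esub> of_real r \<odot>\<^bsub>M\<^esub> u" "a = b + r * c" "(w, b) \<in> H"
      unfolding H'_def by blast
    have "of_real t \<odot>\<^bsub>M\<^esub> v = of_real t \<odot>\<^bsub>M\<^esub> w \<oplus>\<^bsub>M\<^esub> of_real (t * r) \<odot>\<^bsub>M\<^esub> u"
      using * u Hc by (simp add: smult_add_right smult_smult)
    moreover have "t * a = t * b + (t * r) * c" using * by (simp add: algebra_simps)
    ultimately show "(of_real t \<odot>\<^bsub>M\<^esub> v, t * a) \<in> H'"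
      using H'I [OF Hs, of w b t "t * r"] * by simp
  qed
  moreover have "H \<subseteq> H'"
  proof
    fix x assume x: "x \<in> H"
    obtain w b where wb: "x = (w, b)" by fastforce
    show "x \<in> H'" using H'I [of w b 0] x wb Hc u by simp
  qed
  moreover have "(u, c) \<in> H'"
    using H'I [OF H0, of 1] u by simp
  ultimately show ?thesis by blast
qed

lemma dominated_graph_Union:
  assumes "\<C> \<noteq> {}" and chain: "subset.chain {H. dominated_graph M p H} \<C>"
  shows "dominated_graph M p (\<Union>\<C>)"
proof -
  have g: "dominated_graph M p H" if "H \<in> \<C>" for H
    using chain that by (auto simp: subset.chain_def)
  have "\<exists>H\<in>\<C>. x \<in> H \<and> y \<in> H" if "x \<in> \<Union>\<C>" "y \<in> \<Union>\<C>" for x y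
    using chain that unfolding subset_chain_def by blast
  then have two: "\<exists>H. dominated_graph M p H \<and> H \<subseteq> \<Union>\<C> \<and> x \<in> H \<and> y \<in> H"
    if "x \<in> \<Union>\<C>" "y \<in> \<Union>\<C>" for x y
    using g that by (meson Union_upper)
  show ?thesis
    unfolding dominated_graph_def
  proof (intro conjI allI impI)
    obtain H where "H \<in> \<C>" using \<open>\<C> \<noteq> {}\<close> by blast
    then show "(\<zero>\<^bsub>M\<^esub>, 0) \<in> \<Union>\<C>" using g unfolding dominated_graph_def by blast
  next
    fix v a assume "(v, a) \<in> \<Union>\<C>"
    then obtain H where H: "dominated_graph M p H" "(v, a) \<in> H" using g by blast
    then show "v \<in> carrier M" "a \<le> p v" unfolding dominated_graph_def by blast+
  next
    fix v a w b assume "(v, a) \<in> \<Union>\<C>" "(w, b) \<in> \<Union>\<C>"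
    from two [OF this] obtain H where H: "dominated_graph M p H" "H \<subseteq> \<Union>\<C>" "(v, a) \<in> H" "(w, b) \<in> H"
      by blast
    then have "(v \<oplus>\<^bsub>M\<^esub> w, a + b) \<in> H" unfolding dominated_graph_def by simp
    then show "(v \<oplus>\<^bsub>M\<^esub> w, a + b) \<in> \<Union>\<C>" using H by blast
  next
    fix v a and r :: real assume "(v, a) \<in> \<Union>\<C>"
    then obtain H where H: "dominated_graph M p H" "H \<in> \<C>" "(v, a) \<in> H" using g by blast
    then have "(of_real r \<odot>\<^bsub>M\<^esub> v, r * a) \<in> H" unfolding dominated_graph_def by simp
    then show "(of_real r \<odot>\<^bsub>M\<^esub> v, r * a) \<in> \<Union>\<C>" using H by blast
  qed
qed

text \<open>
  By Zorn's lemma there is a maximal dominated graph above \<open>H\<close>; the extension step shows that its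
  domain is everything.
\<close>

lemma real_hahn_banach:
  assumes "dominated_graph M p H"
  obtains f :: "'v \<Rightarrow> real" where
    "\<And>x y. x \<in> carrier M \<Longrightarrow> y \<in> carrier M \<Longrightarrow> f (x \<oplus>\<^bsub>M\<^esub> y) = f x + f y"
    "\<And>r x. x \<in> carrier M \<Longrightarrow> f (of_real r \<odot>\<^bsub>M\<^esub> x) = r * f x"
    "\<And>x. x \<in> carrier M \<Longrightarrow> f x \<le> p x"
    "\<And>x a. (x, a) \<in> H \<Longrightarrow> f x = a"
proof -
  let ?A = "{K. dominated_graph M p K \<and> H \<subseteq> K}"
  have "\<exists>K\<in>?A. \<forall>X\<in>?A. K \<subseteq> X \<longrightarrow> X = K"
  proof (rule subset_Zorn_nonempty)
    show "?A \<noteq> {}" using assms by blast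
    fix \<C> assume C: "\<C> \<noteq> {}" "subset.chain ?A \<C>"
    then have "subset.chain {H. dominated_graph M p H} \<C>"
      by (auto simp: subset_chain_def)
    moreover have "H \<subseteq> \<Union>\<C>" using C unfolding subset_chain_def by blast
    ultimately show "\<Union>\<C> \<in> ?A" using C dominated_graph_Union by blast
  qed
  then obtain K where "K \<in> ?A" and maxA: "\<forall>X\<in>?A. K \<subseteq> X \<longrightarrow> X = K" ..
  then have K: "dominated_graph M p K" "H \<subseteq> K" by simp_all
  have max: "X = K" if "dominated_graph M p X" "K \<subseteq> X" for X
    using maxA that K(2) by simp
  have Kc: "(v, a) \<in> K \<Longrightarrow> v \<in> carrier M" and Kp: "(v, a) \<in> K \<Longrightarrow> a \<le> p v"
    and Ka: "(v, a) \<in> K \<Longrightarrow> (w, b) \<in> K \<Longrightarrow> (v \<oplus>\<^bsub>M\<^esub> w, a + b) \<in> K"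
    and Ks: "(v, a) \<in> K \<Longrightarrow> (of_real r \<odot>\<^bsub>M\<^esub> v, r * a) \<in> K" for v w a b r
    using K(1) unfolding dominated_graph_def by blast+
  have le: "a \<le> b" if "(v, a) \<in> K" "(v, b) \<in> K" for v a b
  proof -
    have "(v \<oplus>\<^bsub>M\<^esub> of_real (-1) \<odot>\<^bsub>M\<^esub> v, a + (-1) * b) \<in> K" using Ka [OF that(1) Ks [OF that(2)]] .
    moreover have "v \<oplus>\<^bsub>M\<^esub> of_real (-1) \<odot>\<^bsub>M\<^esub> v = \<zero>\<^bsub>M\<^esub>"
      using Kc [OF that(1)] minus_eq_smult [of v] r_neg [of v] by simp
    ultimately show ?thesis using Kp p_zero by fastforce
  qed
  have total: "\<exists>a. (v, a) \<in> K" if "v \<in> carrier M" for v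
    using dominated_graph_extend [OF K(1) that] max by blast
  define f where "f v = (SOME a. (v, a) \<in> K)" for v
  have fK: "(v, f v) \<in> K" if "v \<in> carrier M" for v
    unfolding f_def using total [OF that] by (rule someI_ex)
  have f: "f v = a" if "(v, a) \<in> K" for v a
    using le fK Kc that by (meson order_antisym)
  show thesis
  proof
    show "f (x \<oplus>\<^bsub>M\<^esub> y) = f x + f y" if "x \<in> carrier M" "y \<in> carrier M" for x y
      using that by (intro f Ka fK)
    show "f (of_real r \<odot>\<^bsub>M\<^esub> x) = r * f x" if "x \<in> carrier M" for r x
      using that by (intro f Ks fK)
    show "f x \<le> p x" if "x \<in> carrier M" for x using Kp fK that by blast
    show "f x = a" if "(x, a) \<in> H" for x a using that K f by blast
  qed
qed

text \<open>
  The real part of the given functional extends by the real theorem to some \<open>f\<close>, and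
  \<open>v \<mapsto> f v - \<i> f (\<i> v)\<close> is complex linear with real part \<open>f\<close>.
\<close>

lemma complex_hahn_banach:
  fixes H :: "('v \<times> complex) set"
  assumes zero: "(\<zero>\<^bsub>M\<^esub>, 0) \<in> H"
    and car: "\<And>v a. (v, a) \<in> H \<Longrightarrow> v \<in> carrier M"
    and add: "\<And>v a w b. (v, a) \<in> H \<Longrightarrow> (w, b) \<in> H \<Longrightarrow> (v \<oplus>\<^bsub>M\<^esub> w, a + b) \<in> H"
    and smult: "\<And>v a c. (v, a) \<in> H \<Longrightarrow> (c \<odot>\<^bsub>M\<^esub> v, c * a) \<in> H"
    and le: "\<And>v a. (v, a) \<in> H \<Longrightarrow> cmod a \<le> p v"
  obtains \<Phi> :: "'v \<Rightarrow> complex" where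
    "\<And>x y. x \<in> carrier M \<Longrightarrow> y \<in> carrier M \<Longrightarrow> \<Phi> (x \<oplus>\<^bsub>M\<^esub> y) = \<Phi> x + \<Phi> y"
    "\<And>c x. x \<in> carrier M \<Longrightarrow> \<Phi> (c \<odot>\<^bsub>M\<^esub> x) = c * \<Phi> x"
    "\<And>x. x \<in> carrier M \<Longrightarrow> cmod (\<Phi> x) \<le> p x"
    "\<And>x a. (x, a) \<in> H \<Longrightarrow> \<Phi> x = a"
proof -
  define H' where "H' = {(v, Re a) | v a. (v, a) \<in> H}"
  have "dominated_graph M p H'"
    unfolding dominated_graph_def
  proof (intro conjI allI impI)
    show "(\<zero>\<^bsub>M\<^esub>, 0) \<in> H'" unfolding H'_def using zero by force
  next
    fix v a assume "(v, a) \<in> H'"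
    then obtain b where b: "a = Re b" "(v, b) \<in> H" unfolding H'_def by blast
    then show "v \<in> carrier M" "a \<le> p v"
      using car le [OF b(2)] complex_Re_le_cmod [of b] by auto
  next
    fix v a w b assume "(v, a) \<in> H'" "(w, b) \<in> H'"
    then obtain a' b' where "a = Re a'" "b = Re b'" "(v, a') \<in> H" "(w, b') \<in> H"
      unfolding H'_def by blast
    then show "(v \<oplus>\<^bsub>M\<^esub> w, a + b) \<in> H'"
      unfolding H'_def using add by (auto intro!: exI [of _ "a' + b'"])
  next
    fix v a and r :: real assume "(v, a) \<in> H'"
    then obtain a' where "a = Re a'" "(v, a') \<in> H" unfolding H'_def by blast
    then show "(of_real r \<odot>\<^bsub>M\<^esub> v, r * a) \<in> H'"
      unfolding H'_def using smult by (auto intro!: exI [of _ "of_real r * a'"])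
  qed
  then obtain f :: "'v \<Rightarrow> real" where
    fa: "\<And>x y. x \<in> carrier M \<Longrightarrow> y \<in> carrier M \<Longrightarrow> f (x \<oplus>\<^bsub>M\<^esub> y) = f x + f y" and
    fs: "\<And>r x. x \<in> carrier M \<Longrightarrow> f (of_real r \<odot>\<^bsub>M\<^esub> x) = r * f x" and
    fp: "\<And>x. x \<in> carrier M \<Longrightarrow> f x \<le> p x" and
    fH: "\<And>x a. (x, a) \<in> H' \<Longrightarrow> f x = a"
    using real_hahn_banach by blast
  define \<Phi> where "\<Phi> x = Complex (f x) (- f (\<i> \<odot>\<^bsub>M\<^esub> x))" for x
  have \<Phi>a: "\<Phi> (x \<oplus>\<^bsub>M\<^esub> y) = \<Phi> x + \<Phi> y" if "x \<in> carrier M" "y \<in> carrier M" for x y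
    using that by (simp add: \<Phi>_def fa smult_add_right complex_eq_iff)
  have \<Phi>s: "\<Phi> (c \<odot>\<^bsub>M\<^esub> x) = c * \<Phi> x" if x: "x \<in> carrier M" for c x
  proof -
    have f: "f (c \<odot>\<^bsub>M\<^esub> x) = Re c * f x + Im c * f (\<i> \<odot>\<^bsub>M\<^esub> x)" for c
    proof -
      have "c \<odot>\<^bsub>M\<^esub> x = (of_real (Re c) + of_real (Im c) * \<i>) \<odot>\<^bsub>M\<^esub> x"
        by (simp add: complex_eq [symmetric] mult.commute)
      also have "\<dots> = of_real (Re c) \<odot>\<^bsub>M\<^esub> x \<oplus>\<^bsub>M\<^esub> of_real (Im c) \<odot>\<^bsub>M\<^esub> (\<i> \<odot>\<^bsub>M\<^esub> x)"
        using x by (simp add: smult_add_left smult_smult)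
      finally show ?thesis using x by (simp only: fa fs smult_in)
    qed
    show ?thesis
      using x f [of c] f [of "\<i> * c"] by (simp add: \<Phi>_def smult_smult complex_eq_iff)
  qed
  show thesis
  proof
    show "cmod (\<Phi> x) \<le> p x" if x: "x \<in> carrier M" for x
    proof -
      \<comment> \<open>Rotating \<open>x\<close> makes the value of \<open>\<Phi>\<close> real and non-negative.\<close>
      define c where "c = (if \<Phi> x = 0 then 1 else cnj (sgn (\<Phi> x)))"
      have c: "cmod c = 1" by (simp add: c_def norm_sgn)
      have "cnj w / of_real (cmod w) * w = of_real (cmod w)" if "w \<noteq> 0" for w
        using that complex_norm_square [of w] by (simp add: field_simps power2_eq_square)
      then have "c * \<Phi> x = of_real (cmod (\<Phi> x))"
        by (simp add: c_def sgn_eq)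
      then have "cmod (\<Phi> x) = Re (\<Phi> (c \<odot>\<^bsub>M\<^esub> x))" using x by (simp add: \<Phi>s)
      also have "\<dots> = f (c \<odot>\<^bsub>M\<^esub> x)" by (simp add: \<Phi>_def)
      also have "\<dots> \<le> p (c \<odot>\<^bsub>M\<^esub> x)" using x by (intro fp) auto
      also have "\<dots> = p x" using x c by (simp add: p_smult)
      finally show ?thesis .
    qed
    show "\<Phi> x = a" if "(x, a) \<in> H" for x a
    proof -
      have fRe: "f v = Re b" if "(v, b) \<in> H" for v b
        by (rule fH) (use that in \<open>auto simp: H'_def\<close>)
      have "f x = Re a" "f (\<i> \<odot>\<^bsub>M\<^esub> x) = Re (\<i> * a)"
        by (rule fRe, rule that, rule fRe, rule smult, rule that)
      then show ?thesis by (simp add: \<Phi>_def complex_eq_iff)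
    qed
  qed (use \<Phi>a \<Phi>s in auto)
qed

end

section \<open>Characters and Haar measure on a compact group\<close>

lemma continuous_characterD:
  assumes "continuous_character h"
  shows "continuous_on UNIV h" "cmod (h x) = 1" "h (x + y) = h x * h y"
  using assms by (auto simp: continuous_character_def)

lemma continuous_character_zero: "continuous_character h \<Longrightarrow> h 0 = 1"
  using continuous_characterD(2) [of h 0] continuous_characterD(3) [of h 0 0] by fastforce

lemma continuous_character_minus: 
  assumes "continuous_character h" shows "h (- x) = cnj (h x)"
proof -
  have "h (- x) * h x = 1"
    using continuous_characterD(3) [OF assms, of "- x" x] continuous_character_zero [OF assms] by simp
  moreover have "cnj (h x) * h x = 1"
    using continuous_characterD(2) [OF assms, of x] complex_norm_square [of "h x"]
    by (simp add: mult.commute)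
  moreover have "h x \<noteq> 0" using continuous_characterD(2) [OF assms, of x] by auto
  ultimately show ?thesis by (metis mult_right_cancel)
qed

lemma continuous_character_one: "continuous_character (\<lambda>_. 1)"
  by (simp add: continuous_character_def)

lemma continuous_character_mult:
  "continuous_character h \<Longrightarrow> continuous_character k \<Longrightarrow> continuous_character (\<lambda>x. h x * k x)"
  by (auto simp: continuous_character_def norm_mult intro!: continuous_intros)

lemma continuous_character_cnj:
  "continuous_character h \<Longrightarrow> continuous_character (\<lambda>x. cnj (h x))"
  by (auto simp: continuous_character_def intro!: continuous_intros)

text \<open>
  Finite linear combinations of continuous characters. Building them one character at a time lets
  linear statements about them be proved by rule induction, without indexing the sums.
\<close>

inductive trig_polynomial :: "('g :: {topological_ab_group_add, t2_space} \<Rightarrow> complex) \<Rightarrow> bool" where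
  zero: "trig_polynomial (\<lambda>_. 0)"
| add: "continuous_character \<phi> \<Longrightarrow> trig_polynomial F \<Longrightarrow> trig_polynomial (\<lambda>x. c * \<phi> x + F x)"

lemma trig_polynomial_continuous: "trig_polynomial F \<Longrightarrow> continuous_on UNIV F"
proof (induction rule: trig_polynomial.induct)
  case (add \<phi> F c)
  then show ?case by (intro continuous_on_add continuous_on_mult_left continuous_characterD(1) [OF add.hyps(1)] add.IH)
qed simp

lemma trig_polynomial_add:
  "trig_polynomial F \<Longrightarrow> trig_polynomial G \<Longrightarrow> trig_polynomial (\<lambda>x. F x + G x)"
proof (induction rule: trig_polynomial.induct)
  case (add \<phi> F c)
  then show ?case using trig_polynomial.add [of \<phi> "\<lambda>x. F x + G x" c] by (simp add: add.assoc)
qed simp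

lemma trig_polynomial_character: "continuous_character \<phi> \<Longrightarrow> trig_polynomial (\<lambda>x. c * \<phi> x)"
  using trig_polynomial.add [OF _ trig_polynomial.zero] by fastforce

lemma trig_polynomial_const: "trig_polynomial (\<lambda>x. c)"
  using trig_polynomial_character [OF continuous_character_one] by simp

lemma trig_polynomial_character_mult:
  assumes "continuous_character \<phi>" and "trig_polynomial F"
  shows "trig_polynomial (\<lambda>x. c * \<phi> x * F x)"
  using assms(2)
proof (induction rule: trig_polynomial.induct)
  case zero
  then show ?case by (simp add: trig_polynomial.zero)
next
  case (add \<psi> F d)
  have "trig_polynomial (\<lambda>x. c * d * (\<phi> x * \<psi> x) + c * \<phi> x * F x)"
    by (intro trig_polynomial.add continuous_character_mult assms add)
  then show ?case by (simp add: algebra_simps)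
qed

lemma trig_polynomial_mult:
  "trig_polynomial F \<Longrightarrow> trig_polynomial G \<Longrightarrow> trig_polynomial (\<lambda>x. F x * G x)"
proof (induction rule: trig_polynomial.induct)
  case (add \<phi> F c)
  have "trig_polynomial (\<lambda>x. c * \<phi> x * G x + F x * G x)"
    by (intro trig_polynomial_add trig_polynomial_character_mult add)
  then show ?case by (simp add: algebra_simps)
qed (simp add: trig_polynomial.zero)

lemma trig_polynomial_cnj: "trig_polynomial F \<Longrightarrow> trig_polynomial (\<lambda>x. cnj (F x))"
proof (induction rule: trig_polynomial.induct)
  case (add \<phi> F c)
  then show ?case
    using trig_polynomial.add [OF continuous_character_cnj, of \<phi> "\<lambda>x. cnj (F x)" "cnj c"] by simp
qed (simp add: trig_polynomial.zero)

lemma trig_polynomial_sum: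
  "(\<And>n. n \<in> A \<Longrightarrow> trig_polynomial (F n)) \<Longrightarrow> trig_polynomial (\<lambda>x. \<Sum>n\<in>A. F n x)"
  by (induction A rule: infinite_finite_induct) (auto intro: trig_polynomial.zero trig_polynomial_add)

lemma trig_polynomial_real_polynomial:
  assumes "real_polynomial_function q" and "trig_polynomial (\<lambda>x. of_real (u x))"
  shows "trig_polynomial (\<lambda>x. of_real (q (u x :: real)))"
  using assms(1)
proof (induction rule: real_polynomial_function.induct)
  case (linear f)
  then have "f y = f 1 * y" for y :: real
    using linear_cmul [OF bounded_linear.linear, of f y 1] by simp
  then have "(\<lambda>x. complex_of_real (f (u x))) = (\<lambda>x. of_real (f 1) * of_real (u x))" by (metis of_real_mult)
  then show ?case using trig_polynomial_mult [OF trig_polynomial_const assms(2)] by simp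
next
  case (const c)
  then show ?case by (rule trig_polynomial_const)
next
  case (add f g)
  then show ?case using trig_polynomial_add by simp
next
  case (mult f g)
  then show ?case using trig_polynomial_mult by simp
qed

locale compact_group_haar =
  fixes m :: "'g :: {topological_ab_group_add, t2_space} measure"
  assumes compact_G: "compact (UNIV :: 'g set)"
    and haar: "normalized_haar_measure m"
begin

lemma sets_m: "sets m = sets borel" using haar by (simp add: normalized_haar_measure_def)

lemma emeasure_translate:
  assumes A: "A \<in> sets m" shows "emeasure m ((+) g ` A) = emeasure m A"
proof -
  have "\<forall>g. \<forall>A\<in>sets m. emeasure m ((+) g ` A) = emeasure m A"
    using haar unfolding normalized_haar_measure_def by (elim conjE) assumption
  then show ?thesis using A by simp
qed

lemma space_m: "space m = UNIV" using sets_eq_imp_space_eq [OF sets_m] by simp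

lemma measure_m: "measure m UNIV = 1"
  using haar by (simp add: normalized_haar_measure_def measure_def)

sublocale finite_measure m
  by (rule finite_measureI) (use haar space_m in \<open>simp add: normalized_haar_measure_def\<close>)

lemma continuous_measurable:
  fixes f :: "'g \<Rightarrow> 'b :: topological_space"
  shows "continuous_on UNIV f \<Longrightarrow> f \<in> borel_measurable m"
  using borel_measurable_continuous_onI measurable_cong_sets [OF sets_m refl] by blast

lemma continuous_integrable:
  fixes f :: "'g \<Rightarrow> 'b :: {banach, second_countable_topology}"
  assumes "continuous_on UNIV f"
  shows "integrable m f"
proof -
  have "bounded (range f)"
    using compact_continuous_image [OF assms compact_G] by (rule compact_imp_bounded)
  then obtain B where "\<And>x. norm (f x) \<le> B" by (auto simp: bounded_iff)
  then show ?thesis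
    by (intro integrable_const_bound [of _ B] continuous_measurable assms) simp
qed

lemma integral_mono_continuous:
  fixes f g :: "'g \<Rightarrow> real"
  assumes "continuous_on UNIV f" "continuous_on UNIV g" "\<And>x. f x \<le> g x"
  shows "integral\<^sup>L m f \<le> integral\<^sup>L m g"
  by (intro integral_mono continuous_integrable assms)

lemma integral_const: "(\<integral>x. (c :: 'b :: {banach, second_countable_topology}) \<partial>m) = c"
  using space_m measure_m by simp

lemma integral_translate:
  fixes f :: "'g \<Rightarrow> 'b :: {banach, second_countable_topology}"
  assumes "continuous_on UNIV f"
  shows "(\<integral>x. f (g + x) \<partial>m) = (\<integral>x. f x \<partial>m)"
proof -
  have cont: "continuous_on UNIV (\<lambda>x. a + x :: 'g)" for a
    by (intro continuous_intros)
  then have meas: "(\<lambda>x. a + x) \<in> measurable m m" for a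
    using borel_measurable_continuous_onI measurable_cong_sets [OF sets_m sets_m] by blast
  have "distr m m (\<lambda>x. g + x) = m"
  proof (rule measure_eqI)
    fix A assume "A \<in> sets (distr m m (\<lambda>x. g + x))"
    then have A: "A \<in> sets m" by simp
    have "(\<lambda>x. g + x) -` A = (\<lambda>x. - g + x) ` A"
      by (force simp: image_iff algebra_simps intro: bexI [of _ "g + _"])
    moreover have "emeasure m ((+) (- g) ` A) = emeasure m A"
      by (rule emeasure_translate [OF A])
    ultimately show "emeasure (distr m m (\<lambda>x. g + x)) A = emeasure m A"
      by (simp only: emeasure_distr [OF meas A] space_m Int_UNIV_right)
  qed simp
  then show ?thesis
    using integral_distr [OF meas continuous_measurable [OF assms], of g] by simp
qed

text \<open>
  Translating by a point \<open>g\<close> with \<open>\<phi> g \<noteq> h g\<close> multiplies the integral by a number different from \<open>1\<close>,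
  so it vanishes.
\<close>

lemma integral_character_orthogonal:
  assumes \<phi>: "continuous_character \<phi>" and h: "continuous_character h"
  shows "(\<integral>x. \<phi> x * cnj (h x) \<partial>m) = (if \<phi> = h then 1 else 0)"
proof (cases "\<phi> = h")
  case True
  then have "\<phi> x * cnj (h x) = 1" for x
    using continuous_characterD(2) [OF h, of x] complex_norm_square [of "h x"] by simp
  then show ?thesis using True by (simp only: integral_const simp_thms if_True)
next
  case False
  let ?\<psi> = "\<lambda>x. \<phi> x * cnj (h x)"
  have \<psi>: "continuous_character ?\<psi>"
    by (intro continuous_character_mult continuous_character_cnj \<phi> h)
  obtain g where g: "\<phi> g \<noteq> h g" using False by blast
  have "?\<psi> g \<noteq> 1"
  proof
    assume "?\<psi> g = 1"
    moreover have "h g * cnj (h g) = 1"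
      using continuous_characterD(2) [OF h, of g] complex_norm_square [of "h g"] by simp
    moreover have "h g \<noteq> 0" using continuous_characterD(2) [OF h, of g] by auto
    ultimately show False using g by (metis complex_cnj_zero_iff mult_right_cancel)
  qed
  moreover have "?\<psi> g * (\<integral>x. ?\<psi> x \<partial>m) = (\<integral>x. ?\<psi> x \<partial>m)"
  proof -
    have "?\<psi> g * (\<integral>x. ?\<psi> x \<partial>m) = (\<integral>x. ?\<psi> g * ?\<psi> x \<partial>m)" by simp
    also have "\<dots> = (\<integral>x. ?\<psi> (g + x) \<partial>m)" using continuous_characterD(3) [OF \<psi>] by simp
    also have "\<dots> = (\<integral>x. ?\<psi> x \<partial>m)"
      by (rule integral_translate [OF continuous_characterD(1) [OF \<psi>]])
    finally show ?thesis .
  qed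
  ultimately show ?thesis using False by auto
qed

end

section \<open>Dirichlet polynomials as trigonometric polynomials\<close>

lemma represents_frequency_unique:
  assumes \<beta>: "closure (range \<beta>) = UNIV"
    and h: "represents_frequency \<beta> w h" and k: "represents_frequency \<beta> w k"
  shows "h = k"
proof -
  have "closed {x. h x = k x}"
    using h k by (intro closed_Collect_eq) (auto simp: represents_frequency_def continuous_character_def)
  moreover have "range \<beta> \<subseteq> {x. h x = k x}"
    using h k by (auto simp: represents_frequency_def)
  ultimately have "closure (range \<beta>) \<subseteq> {x. h x = k x}" by (metis closure_minimal)
  then show ?thesis using \<beta> by auto
qed

locale dirichlet_haar = compact_group_haar m
  for m :: "'g :: {topological_ab_group_add, t2_space} measure" +
  fixes J :: "nat set" and \<omega> :: "nat \<Rightarrow> real" and \<beta> :: "real \<Rightarrow> 'g"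
  assumes finite_J: "finite J" and inj_\<omega>: "inj \<omega>"
    and omega_group: "omega_dirichlet_group \<omega> \<beta>"
begin

abbreviation "X \<equiv> dirichlet_polynomials J \<omega>"

definition h :: "nat \<Rightarrow> 'g \<Rightarrow> complex" where
  "h n = frequency_character \<beta> (\<omega> n)"

lemma \<beta>_dense: "closure (range \<beta>) = UNIV" and \<beta>_cont: "continuous_on UNIV \<beta>"
  and \<beta>_add: "\<beta> (s + t) = \<beta> s + \<beta> t"
  using omega_group by (auto simp: omega_dirichlet_group_def dirichlet_group_def)

lemma represents_h: "represents_frequency \<beta> (\<omega> n) (h n)"
proof -
  obtain k where k: "represents_frequency \<beta> (\<omega> n) k"
    using omega_group by (auto simp: omega_dirichlet_group_def)
  have "(THE k. represents_frequency \<beta> (\<omega> n) k) = k"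
    by (rule the_equality, rule k) (rule represents_frequency_unique [OF \<beta>_dense _ k])
  then show ?thesis
    unfolding h_def frequency_character_def using k by (simp only:)
qed

lemma h_character: "continuous_character (h n)"
  and h_\<beta>: "h n (\<beta> t) = exp (- (\<i> * of_real (\<omega> n) * of_real t))"
  using represents_h [of n] by (auto simp: represents_frequency_def)

lemmas h_cont = continuous_characterD(1) [OF h_character]

lemma continuous_on_h [continuous_intros]:
  "continuous_on A f \<Longrightarrow> continuous_on A (\<lambda>x. h n (f x))"
  using continuous_on_compose2 [OF h_cont] by blast

text \<open>
  If \<open>\<omega> n \<noteq> \<omega> k\<close>, the quotient of the two characters takes the value \<open>-1\<close> at
  \<open>\<beta> (\<pi> / (\<omega> n - \<omega> k))\<close>.
\<close>

lemma h_inj: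
  assumes "h n = h k" shows "n = k"
proof (rule ccontr)
  assume "n \<noteq> k"
  then have d: "\<omega> n - \<omega> k \<noteq> 0" using inj_\<omega> by (auto dest: injD)
  define t where "t = pi / (\<omega> n - \<omega> k)"
  have "exp (- (\<i> * of_real (\<omega> n) * of_real t)) = exp (- (\<i> * of_real (\<omega> k) * of_real t))"
    using assms h_\<beta> by metis
  then have "exp (\<i> * of_real (\<omega> n) * of_real t) = exp (\<i> * of_real (\<omega> k) * of_real t)"
    by (metis exp_minus inverse_inverse_eq)
  then have "exp (\<i> * of_real (\<omega> n) * of_real t - \<i> * of_real (\<omega> k) * of_real t) = 1"
    by (simp add: exp_diff)
  moreover have "\<i> * of_real (\<omega> n) * of_real t - \<i> * of_real (\<omega> k) * of_real t
      = of_real ((\<omega> n - \<omega> k) * t) * \<i>" by (simp add: algebra_simps)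
  moreover have "(\<omega> n - \<omega> k) * t = pi" using d by (simp add: t_def)
  ultimately show False by simp
qed

lemma h_orthonormal: "(\<integral>x. h n x * cnj (h k x) \<partial>m) = (if n = k then 1 else 0)"
  using integral_character_orthogonal [OF h_character h_character] h_inj by auto

text \<open>
  A coefficient family \<open>a\<close> gives the Dirichlet polynomial \<open>dpoly a\<close> and the trigonometric polynomial
  \<open>gpoly a\<close> on the group. The second composed with \<open>\<beta>\<close> is the first on the imaginary axis, and by
  density of the range of \<open>\<beta>\<close> both have the same supremum norm.
\<close>

definition dpoly :: "(nat \<Rightarrow> complex) \<Rightarrow> complex \<Rightarrow> complex" where
  "dpoly a = (\<lambda>s. \<Sum>n\<in>J. a n * exp (- of_real (\<omega> n) * s))"

definition gpoly :: "(nat \<Rightarrow> complex) \<Rightarrow> 'g \<Rightarrow> complex" where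
  "gpoly a x = (\<Sum>n\<in>J. a n * h n x)"

lemma dpoly_gpoly: "dpoly a (\<i> * of_real t) = gpoly a (\<beta> t)"
  unfolding dpoly_def gpoly_def h_\<beta> by (intro sum.cong refl) (simp add: mult_ac)

lemma carrier_X: "carrier X = range dpoly"
  by (auto simp: dirichlet_polynomials_def dpoly_def)

lemma dpoly_in [simp]: "dpoly a \<in> carrier X" by (simp add: carrier_X)

lemma dpoly_add: "dpoly a \<oplus>\<^bsub>X\<^esub> dpoly b = dpoly (\<lambda>n. a n + b n)"
  by (simp add: dirichlet_polynomials_def dpoly_def algebra_simps sum.distrib)

lemma dpoly_smult: "c \<odot>\<^bsub>X\<^esub> dpoly a = dpoly (\<lambda>n. c * a n)"
  by (simp add: dirichlet_polynomials_def dpoly_def algebra_simps sum_distrib_left)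

lemma nrm_X: "nrm X D = (SUP t. cmod (D (\<i> * of_real t)))"
  by (simp add: dirichlet_polynomials_def)

lemma gpoly_cont [continuous_intros]:
  "continuous_on A f \<Longrightarrow> continuous_on A (\<lambda>x. gpoly a (f x))"
  unfolding gpoly_def by (intro continuous_intros)

lemma dpoly_bdd: "bdd_above (range (\<lambda>t. cmod (dpoly a (\<i> * of_real t))))"
proof (rule bdd_aboveI2)
  fix t
  have "cmod (gpoly a (\<beta> t)) \<le> (\<Sum>n\<in>J. cmod (a n))"
    unfolding gpoly_def
    by (intro sum_norm_le) (simp add: norm_mult continuous_characterD(2) [OF h_character])
  then show "cmod (dpoly a (\<i> * of_real t)) \<le> (\<Sum>n\<in>J. cmod (a n))" by (simp add: dpoly_gpoly)
qed

lemma nrm_dpoly_upper: "cmod (dpoly a (\<i> * of_real t)) \<le> nrm X (dpoly a)"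
  unfolding nrm_X by (rule cSUP_upper [OF UNIV_I dpoly_bdd])

lemma nrm_dpoly_least: "(\<And>t. cmod (gpoly a (\<beta> t)) \<le> B) \<Longrightarrow> nrm X (dpoly a) \<le> B"
  unfolding nrm_X dpoly_gpoly by (rule cSUP_least) auto

lemma bound_by_density:
  assumes "continuous_on UNIV f" and "\<And>t. cmod (f (\<beta> t)) \<le> B"
  shows "cmod (f x) \<le> B"
proof -
  have "closed {x. cmod (f x) \<le> B}"
    by (intro closed_Collect_le continuous_intros assms)
  then have "closure (range \<beta>) \<subseteq> {x. cmod (f x) \<le> B}"
    by (intro closure_minimal) (use assms in auto)
  then show ?thesis using \<beta>_dense by auto
qed

lemma cmod_gpoly_le: "cmod (gpoly a x) \<le> nrm X (dpoly a)"
  by (rule bound_by_density) (use nrm_dpoly_upper dpoly_gpoly in \<open>auto intro!: continuous_intros\<close>)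

text \<open>
  Convolution with the kernel is the orthogonal projection of \<open>L\<^sup>2(G)\<close> onto the span of the
  characters \<open>h n\<close>, \<open>n \<in> J\<close>; its \<open>L\<^sup>1\<close> norm is the value of the projection constant.
\<close>

definition kernel :: "'g \<Rightarrow> complex" where
  "kernel x = (\<Sum>n\<in>J. h n x)"

definition kernel_norm :: real where
  "kernel_norm = (\<integral>x. cmod (kernel x) \<partial>m)"

lemma kernel_cont [continuous_intros]:
  "continuous_on A f \<Longrightarrow> continuous_on A (\<lambda>x. kernel (f x))"
  unfolding kernel_def by (intro continuous_intros)

end

section \<open>The upper bound\<close>

sublocale complex_normed_space \<subseteq> complex_module Y ..

context complex_normed_space
begin

lemma nrm_zero [simp]: "nrm Y \<zero>\<^bsub>Y\<^esub> = 0"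
  using nrm_eq_0_iff by blast

lemma nrm_finsum_le:
  "finite A \<Longrightarrow> f \<in> A \<rightarrow> carrier Y \<Longrightarrow> nrm Y (\<Oplus>\<^bsub>Y\<^esub>i\<in>A. f i) \<le> (\<Sum>i\<in>A. nrm Y (f i))"
proof (induction rule: finite_induct)
  case (insert x A)
  have "nrm Y (f x \<oplus>\<^bsub>Y\<^esub> (\<Oplus>\<^bsub>Y\<^esub>i\<in>A. f i)) \<le> nrm Y (f x) + nrm Y (\<Oplus>\<^bsub>Y\<^esub>i\<in>A. f i)"
    using insert.prems by (intro nrm_triangle finsum_closed) auto
  then show ?case using insert by (auto simp: finsum_insert)
qed simp

lemma nrm_combination_continuous:
  assumes A: "finite A" and v: "\<And>i. i \<in> A \<Longrightarrow> v i \<in> carrier Y"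
    and c: "\<And>i. i \<in> A \<Longrightarrow> continuous_on S (c i)"
  shows "continuous_on S (\<lambda>z. nrm Y (\<Oplus>\<^bsub>Y\<^esub>i\<in>A. c i z \<odot>\<^bsub>Y\<^esub> v i))"
proof -
  let ?N = "\<lambda>z. nrm Y (\<Oplus>\<^bsub>Y\<^esub>i\<in>A. c i z \<odot>\<^bsub>Y\<^esub> v i)"
  let ?d = "\<lambda>z w. \<Sum>i\<in>A. cmod (c i z - c i w) * nrm Y (v i)"
  have le: "?N z \<le> ?N w + ?d z w" for z w
  proof -
    have "(\<Oplus>\<^bsub>Y\<^esub>i\<in>A. c i z \<odot>\<^bsub>Y\<^esub> v i) = (\<Oplus>\<^bsub>Y\<^esub>i\<in>A. c i w \<odot>\<^bsub>Y\<^esub> v i \<oplus>\<^bsub>Y\<^esub> (c i z - c i w) \<odot>\<^bsub>Y\<^esub> v i)"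
      using v by (intro finsum_cong') (auto simp: smult_add_left [symmetric])
    also have "\<dots> = (\<Oplus>\<^bsub>Y\<^esub>i\<in>A. c i w \<odot>\<^bsub>Y\<^esub> v i) \<oplus>\<^bsub>Y\<^esub> (\<Oplus>\<^bsub>Y\<^esub>i\<in>A. (c i z - c i w) \<odot>\<^bsub>Y\<^esub> v i)"
      using v by (intro finsum_addf) auto
    finally have "?N z \<le> ?N w + nrm Y (\<Oplus>\<^bsub>Y\<^esub>i\<in>A. (c i z - c i w) \<odot>\<^bsub>Y\<^esub> v i)"
      using v by (auto intro!: nrm_triangle finsum_closed)
    also have "nrm Y (\<Oplus>\<^bsub>Y\<^esub>i\<in>A. (c i z - c i w) \<odot>\<^bsub>Y\<^esub> v i) \<le> (\<Sum>i\<in>A. nrm Y ((c i z - c i w) \<odot>\<^bsub>Y\<^esub> v i))"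
      using v A by (intro nrm_finsum_le) auto
    also have "\<dots> = ?d z w" using v by (intro sum.cong) (auto simp: nrm_smult)
    finally show ?thesis by simp
  qed
  have "dist (?N z) (?N w) \<le> dist (?d z w) 0" for z w
    using le [of z w] le [of w z] by (simp add: dist_real_def norm_minus_commute)
  moreover have "((\<lambda>z. ?d z w) \<longlongrightarrow> 0) (at w within S)" if "w \<in> S" for w
  proof -
    have "((\<lambda>z. ?d z w) \<longlongrightarrow> ?d w w) (at w within S)"
      using c that unfolding continuous_on_def by (intro tendsto_intros) auto
    then show ?thesis by simp
  qed
  ultimately show ?thesis
    unfolding continuous_on_def by (blast intro: metric_tendsto_imp_tendsto eventuallyI always_eventually)
qed

end

text \<open>
  The coefficient functionals of the projection are found all at once, as a single functional on
  sequences of vectors of \<open>Y\<close>; the sequences form a module with pointwise operations.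
\<close>

definition sequence_module :: "(complex, 'y, 'b) module_scheme \<Rightarrow> (complex, nat \<Rightarrow> 'y) module" where
  "sequence_module Y =
     \<lparr>carrier = {v. \<forall>n. v n \<in> carrier Y}, mult = (\<lambda>v w. v), one = (\<lambda>n. \<zero>\<^bsub>Y\<^esub>),
      zero = (\<lambda>n. \<zero>\<^bsub>Y\<^esub>), add = (\<lambda>v w n. v n \<oplus>\<^bsub>Y\<^esub> w n), smult = (\<lambda>c v n. c \<odot>\<^bsub>Y\<^esub> v n)\<rparr>"

lemma (in complex_module) complex_module_sequence: "complex_module (sequence_module M)"
proof (intro complex_module.intro Module.moduleI complex_ring_cring abelian_groupI)
  fix v assume v: "v \<in> carrier (sequence_module M)"
  then show "\<exists>w\<in>carrier (sequence_module M). w \<oplus>\<^bsub>sequence_module M\<^esub> v = \<zero>\<^bsub>sequence_module M\<^esub>"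
    by (intro bexI [of _ "\<lambda>n. \<ominus> v n"]) (auto simp: sequence_module_def l_neg)
qed (auto simp: sequence_module_def a_ac smult_add_left smult_add_right smult_smult fun_eq_iff)

locale dirichlet_embedding =
  dirichlet_haar m J \<omega> \<beta> + complex_normed_space Y
  for m :: "'g :: {topological_ab_group_add, t2_space} measure"
    and J :: "nat set" and \<omega> :: "nat \<Rightarrow> real" and \<beta> :: "real \<Rightarrow> 'g" and Y :: "'y normed_module" +
  fixes I :: "(complex \<Rightarrow> complex) \<Rightarrow> 'y"
  assumes embedding: "isometric_embedding X Y I"
begin

lemma I_in [simp, intro]: "I (dpoly a) \<in> carrier Y"
  and I_add: "I (dpoly a) \<oplus>\<^bsub>Y\<^esub> I (dpoly b) = I (dpoly (\<lambda>n. a n + b n))"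
  and I_smult: "c \<odot>\<^bsub>Y\<^esub> I (dpoly a) = I (dpoly (\<lambda>n. c * a n))"
  and I_nrm: "nrm Y (I (dpoly a)) = nrm X (dpoly a)"
proof -
  have I: "I \<in> carrier X \<rightarrow> carrier Y"
    and Ia: "D \<in> carrier X \<Longrightarrow> E \<in> carrier X \<Longrightarrow> I (D \<oplus>\<^bsub>X\<^esub> E) = I D \<oplus>\<^bsub>Y\<^esub> I E"
    and Is: "D \<in> carrier X \<Longrightarrow> I (c \<odot>\<^bsub>X\<^esub> D) = c \<odot>\<^bsub>Y\<^esub> I D"
    and In: "D \<in> carrier X \<Longrightarrow> nrm Y (I D) = nrm X D" for D E c
    using embedding unfolding isometric_embedding_def linear_map_def by auto
  show "I (dpoly a) \<in> carrier Y" using I dpoly_in by blast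
  show "I (dpoly a) \<oplus>\<^bsub>Y\<^esub> I (dpoly b) = I (dpoly (\<lambda>n. a n + b n))"
    using Ia [of "dpoly a" "dpoly b"] by (simp add: dpoly_add)
  show "c \<odot>\<^bsub>Y\<^esub> I (dpoly a) = I (dpoly (\<lambda>n. c * a n))"
    using Is [of "dpoly a" c] by (simp add: dpoly_smult)
  show "nrm Y (I (dpoly a)) = nrm X (dpoly a)" using In by simp
qed

lemma I_zero: "I (dpoly (\<lambda>n. 0)) = \<zero>\<^bsub>Y\<^esub>"
  using I_smult [of 0 "\<lambda>n. 0"] by simp

lemma I_combination:
  "finite A \<Longrightarrow> (\<Oplus>\<^bsub>Y\<^esub>n\<in>A. c n \<odot>\<^bsub>Y\<^esub> I (dpoly (a n))) = I (dpoly (\<lambda>k. \<Sum>n\<in>A. c n * a n k))"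
  by (induction rule: finite_induct) (simp_all add: I_zero I_smult I_add)

text \<open>
  A functional \<open>\<Phi>\<close> on sequences determines a map \<open>P\<close> from \<open>Y\<close> into the Dirichlet polynomials, whose
  \<open>n\<close>-th coefficient at \<open>y\<close> is \<open>\<Phi>\<close> of the sequence that has \<open>y\<close> at position \<open>n\<close> and \<open>0\<close> elsewhere.
  The value of \<open>P y\<close> at a point \<open>x\<close> of the group is then \<open>\<Phi> (h n x y)\<^sub>n\<close>. The seminorm is chosen so
  that it equals \<open>\<parallel>y\<parallel>\<close> times the \<open>L\<^sup>1\<close> norm of the kernel at these sequences, and still dominates the
  trace, which is the value that \<open>\<Phi>\<close> must take on sequences in \<open>I X\<close> in order that \<open>P\<close> be a projection.
\<close>

definition averaged_seminorm :: "(nat \<Rightarrow> 'y) \<Rightarrow> real" where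
  "averaged_seminorm v = (\<integral>z. nrm Y (\<Oplus>\<^bsub>Y\<^esub>n\<in>J. cnj (h n z) \<odot>\<^bsub>Y\<^esub> v n) \<partial>m)"

lemma averaged_integrand_continuous:
  "(\<And>n. v n \<in> carrier Y) \<Longrightarrow>
    continuous_on UNIV (\<lambda>z. nrm Y (\<Oplus>\<^bsub>Y\<^esub>n\<in>J. cnj (h n z) \<odot>\<^bsub>Y\<^esub> v n))"
  by (intro nrm_combination_continuous finite_J continuous_intros)

lemma seminormed_sequences: "seminormed_module (sequence_module Y) averaged_seminorm"
proof (intro seminormed_module.intro seminormed_module_axioms.intro complex_module_sequence)
  fix v w assume "v \<in> carrier (sequence_module Y)" "w \<in> carrier (sequence_module Y)"
  then have v: "\<And>n. v n \<in> carrier Y" and w: "\<And>n. w n \<in> carrier Y" by (auto simp: sequence_module_def)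
  let ?S = "\<lambda>v z. \<Oplus>\<^bsub>Y\<^esub>n\<in>J. cnj (h n z) \<odot>\<^bsub>Y\<^esub> v n"
  have S: "?S (\<lambda>n. v n \<oplus>\<^bsub>Y\<^esub> w n) z = ?S v z \<oplus>\<^bsub>Y\<^esub> ?S w z" for z
    using v w by (simp add: smult_add_right finsum_addf)
  have "averaged_seminorm (v \<oplus>\<^bsub>sequence_module Y\<^esub> w) = (\<integral>z. nrm Y (?S v z \<oplus>\<^bsub>Y\<^esub> ?S w z) \<partial>m)"
    by (simp add: averaged_seminorm_def sequence_module_def S)
  also have "\<dots> \<le> (\<integral>z. nrm Y (?S v z) + nrm Y (?S w z) \<partial>m)"
  proof (rule integral_mono_continuous)
    show "continuous_on UNIV (\<lambda>z. nrm Y (?S v z \<oplus>\<^bsub>Y\<^esub> ?S w z))"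
      unfolding S [symmetric] using v w by (intro averaged_integrand_continuous) auto
    show "continuous_on UNIV (\<lambda>z. nrm Y (?S v z) + nrm Y (?S w z))"
      using v w by (intro continuous_intros averaged_integrand_continuous) auto
    show "nrm Y (?S v z \<oplus>\<^bsub>Y\<^esub> ?S w z) \<le> nrm Y (?S v z) + nrm Y (?S w z)" for z
      using v w by (intro nrm_triangle finsum_closed) auto
  qed
  also have "\<dots> = averaged_seminorm v + averaged_seminorm w"
    unfolding averaged_seminorm_def
    using v w by (intro Bochner_Integration.integral_add continuous_integrable averaged_integrand_continuous) auto
  finally show "averaged_seminorm (v \<oplus>\<^bsub>sequence_module Y\<^esub> w) \<le> averaged_seminorm v + averaged_seminorm w" .
next
  fix v c assume "v \<in> carrier (sequence_module Y)"
  then have v: "\<And>n. v n \<in> carrier Y" by (auto simp: sequence_module_def)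
  have "(\<Oplus>\<^bsub>Y\<^esub>n\<in>J. cnj (h n z) \<odot>\<^bsub>Y\<^esub> (c \<odot>\<^bsub>Y\<^esub> v n)) = c \<odot>\<^bsub>Y\<^esub> (\<Oplus>\<^bsub>Y\<^esub>n\<in>J. cnj (h n z) \<odot>\<^bsub>Y\<^esub> v n)" for z
    using v finite_J by (simp add: finsum_smult smult_smult mult.commute)
  moreover have "nrm Y (c \<odot>\<^bsub>Y\<^esub> (\<Oplus>\<^bsub>Y\<^esub>n\<in>J. cnj (h n z) \<odot>\<^bsub>Y\<^esub> v n))
      = cmod c * nrm Y (\<Oplus>\<^bsub>Y\<^esub>n\<in>J. cnj (h n z) \<odot>\<^bsub>Y\<^esub> v n)" for z
    using v by (intro nrm_smult finsum_closed) auto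
  ultimately show "averaged_seminorm (c \<odot>\<^bsub>sequence_module Y\<^esub> v) = cmod c * averaged_seminorm v"
    by (simp add: averaged_seminorm_def sequence_module_def)
qed

text \<open>
  By orthonormality the trace of \<open>A\<close> is the integral over \<open>z\<close> of
  \<open>\<Sum>n. cnj (h n z) * gpoly (A n) z\<close>. For fixed \<open>z\<close> this is the value at \<open>z\<close> of a single polynomial with
  coefficients \<open>b z\<close>, hence bounded by its supremum norm, which the isometry \<open>I\<close> carries to the
  integrand of the seminorm.
\<close>

lemma trace_le_averaged_seminorm:
  "cmod (\<Sum>n\<in>J. A n n) \<le> averaged_seminorm (\<lambda>n. I (dpoly (A n)))"
proof -
  define b where "b z k = (\<Sum>n\<in>J. cnj (h n z) * A n k)" for z k
  have b: "gpoly (b z) z = (\<Sum>k\<in>J. \<Sum>n\<in>J. A n k * (h k z * cnj (h n z)))" for z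
    by (simp add: gpoly_def b_def sum_distrib_left sum_distrib_right mult_ac)
  have "(\<integral>z. gpoly (b z) z \<partial>m) = (\<Sum>k\<in>J. \<Sum>n\<in>J. A n k * (if k = n then 1 else 0))"
    unfolding b h_orthonormal [symmetric]
    by (subst Bochner_Integration.integral_sum,
        intro continuous_integrable continuous_intros,
        intro sum.cong refl,
        subst Bochner_Integration.integral_sum,
        intro continuous_integrable continuous_intros, simp)
  also have "\<dots> = (\<Sum>n\<in>J. A n n)"
    using finite_J by (simp add: if_distrib [of "(*) _"] sum.delta cong: if_cong)
  finally have "cmod (\<Sum>n\<in>J. A n n) = norm (\<integral>z. gpoly (b z) z \<partial>m)" by simp
  also have "\<dots> \<le> (\<integral>z. cmod (gpoly (b z) z) \<partial>m)"
    by (rule integral_norm_bound)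
  also have "\<dots> \<le> (\<integral>z. nrm Y (I (dpoly (b z))) \<partial>m)"
  proof (rule integral_mono_continuous)
    show "continuous_on UNIV (\<lambda>z. cmod (gpoly (b z) z))"
      unfolding b by (intro continuous_intros)
    show "continuous_on UNIV (\<lambda>z. nrm Y (I (dpoly (b z))))"
      using averaged_integrand_continuous [of "\<lambda>n. I (dpoly (A n))"]
      unfolding I_combination [OF finite_J] b_def by simp
    show "cmod (gpoly (b z) z) \<le> nrm Y (I (dpoly (b z)))" for z
      unfolding I_nrm by (rule cmod_gpoly_le)
  qed
  also have "\<dots> = averaged_seminorm (\<lambda>n. I (dpoly (A n)))"
    unfolding averaged_seminorm_def I_combination [OF finite_J] b_def ..
  finally show ?thesis .
qed

text \<open>
  The integrand is \<open>\<bar>kernel (z - x)\<bar> \<parallel>y\<parallel>\<close>, and Haar measure is translation invariant.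
\<close>

lemma averaged_seminorm_point:
  assumes y: "y \<in> carrier Y"
  shows "averaged_seminorm (\<lambda>n. h n x \<odot>\<^bsub>Y\<^esub> y) = kernel_norm * nrm Y y"
proof -
  have 1: "(\<Oplus>\<^bsub>Y\<^esub>n\<in>J. cnj (h n z) \<odot>\<^bsub>Y\<^esub> (h n x \<odot>\<^bsub>Y\<^esub> y)) = cnj (kernel (- x + z)) \<odot>\<^bsub>Y\<^esub> y" for z
  proof -
    have "(\<Oplus>\<^bsub>Y\<^esub>n\<in>J. cnj (h n z) \<odot>\<^bsub>Y\<^esub> (h n x \<odot>\<^bsub>Y\<^esub> y)) = (\<Sum>n\<in>J. cnj (h n z) * h n x) \<odot>\<^bsub>Y\<^esub> y"
      using y finite_J by (simp add: smult_smult finsum_smult_left)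
    also have "(\<Sum>n\<in>J. cnj (h n z) * h n x) = cnj (kernel (- x + z))"
      by (simp add: kernel_def continuous_characterD(3) [OF h_character]
            continuous_character_minus [OF h_character] mult.commute del: uminus_add_conv_diff)
    finally show ?thesis .
  qed
  have "averaged_seminorm (\<lambda>n. h n x \<odot>\<^bsub>Y\<^esub> y) = (\<integral>z. cmod (kernel (- x + z)) * nrm Y y \<partial>m)"
    unfolding averaged_seminorm_def 1 using y by (simp add: nrm_smult del: uminus_add_conv_diff)
  also have "\<dots> = (\<integral>z. cmod (kernel (- x + z)) \<partial>m) * nrm Y y" by simp
  also have "(\<integral>z. cmod (kernel (- x + z)) \<partial>m) = kernel_norm"
    unfolding kernel_norm_def
    by (rule integral_translate [of "\<lambda>z. cmod (kernel z)"]) (intro continuous_intros)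
  finally show ?thesis .
qed

text \<open>
  The trace on sequences of embedded Dirichlet polynomials extends to a functional \<open>\<Phi>\<close> dominated by the
  averaged seminorm, and \<open>\<Phi>\<close> is turned into a projection as described at \<open>averaged_seminorm\<close>.
\<close>

lemma projection_exists:
  "\<exists>P. is_projection (I ` carrier X) Y P \<and> op_norm Y Y P \<le> ennreal kernel_norm"
proof -
  interpret V: seminormed_module "sequence_module Y" averaged_seminorm
    by (rule seminormed_sequences)
  have V_simps: "carrier (sequence_module Y) = {v. \<forall>n. v n \<in> carrier Y}"
    "v \<oplus>\<^bsub>sequence_module Y\<^esub> w = (\<lambda>n. v n \<oplus>\<^bsub>Y\<^esub> w n)" "\<zero>\<^bsub>sequence_module Y\<^esub> = (\<lambda>n. \<zero>\<^bsub>Y\<^esub>)"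
    "c \<odot>\<^bsub>sequence_module Y\<^esub> v = (\<lambda>n. c \<odot>\<^bsub>Y\<^esub> v n)" for v w c
    by (simp_all add: sequence_module_def)
  \<comment> \<open>The graph of the trace is parametrized by coefficients, since the sequence does not determine
    \<open>A n k\<close> for \<open>k\<close> outside \<open>J\<close>.\<close>
  define T where "T = {(\<lambda>n. I (dpoly (A n)), \<Sum>n\<in>J. A n n) | A. True}"
  have TI: "(\<lambda>n. I (dpoly (A n)), \<Sum>n\<in>J. A n n) \<in> T" for A
    unfolding T_def by blast
  obtain \<Phi> where
    add: "\<And>v w. v \<in> carrier (sequence_module Y) \<Longrightarrow> w \<in> carrier (sequence_module Y) \<Longrightarrow>
            \<Phi> (v \<oplus>\<^bsub>sequence_module Y\<^esub> w) = \<Phi> v + \<Phi> w" and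
    smult: "\<And>c v. v \<in> carrier (sequence_module Y) \<Longrightarrow> \<Phi> (c \<odot>\<^bsub>sequence_module Y\<^esub> v) = c * \<Phi> v" and
    le: "\<And>v. v \<in> carrier (sequence_module Y) \<Longrightarrow> cmod (\<Phi> v) \<le> averaged_seminorm v" and
    trace: "\<And>v a. (v, a) \<in> T \<Longrightarrow> \<Phi> v = a"
  proof (rule V.complex_hahn_banach [of T])
    show "(\<zero>\<^bsub>sequence_module Y\<^esub>, 0) \<in> T"
      using TI [of "\<lambda>_ _. 0"] by (simp add: V_simps I_zero)
  next
    fix v a assume "(v, a) \<in> T"
    then obtain A where A: "v = (\<lambda>n. I (dpoly (A n)))" "a = (\<Sum>n\<in>J. A n n)" unfolding T_def by blast
    show "v \<in> carrier (sequence_module Y)" by (simp add: A V_simps)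
    show "cmod a \<le> averaged_seminorm v" unfolding A by (rule trace_le_averaged_seminorm)
    show "(c \<odot>\<^bsub>sequence_module Y\<^esub> v, c * a) \<in> T" for c
      using TI [of "\<lambda>n k. c * A n k"] by (simp add: A V_simps I_smult sum_distrib_left)
  next
    fix v a w b assume "(v, a) \<in> T" "(w, b) \<in> T"
    then obtain A B where A: "v = (\<lambda>n. I (dpoly (A n)))" "a = (\<Sum>n\<in>J. A n n)"
      "w = (\<lambda>n. I (dpoly (B n)))" "b = (\<Sum>n\<in>J. B n n)" unfolding T_def by blast
    show "(v \<oplus>\<^bsub>sequence_module Y\<^esub> w, a + b) \<in> T"
      using TI [of "\<lambda>n k. A n k + B n k"] by (simp add: A V_simps I_add sum.distrib)
  qed blast
  define slot where "slot n y = (\<lambda>k. if k = n then y else \<zero>\<^bsub>Y\<^esub>)" for n :: nat and y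
  define \<phi> where "\<phi> y = (\<lambda>n. \<Phi> (slot n y))" for y
  have slot: "slot n y \<in> carrier (sequence_module Y)" if "y \<in> carrier Y" for n y
    using that by (simp add: V_simps slot_def)
  have \<phi>_add: "\<phi> (x \<oplus>\<^bsub>Y\<^esub> y) = (\<lambda>n. \<phi> x n + \<phi> y n)" if "x \<in> carrier Y" "y \<in> carrier Y" for x y
  proof
    fix n
    have "slot n (x \<oplus>\<^bsub>Y\<^esub> y) = slot n x \<oplus>\<^bsub>sequence_module Y\<^esub> slot n y"
      by (auto simp: V_simps slot_def fun_eq_iff)
    then show "\<phi> (x \<oplus>\<^bsub>Y\<^esub> y) n = \<phi> x n + \<phi> y n" using that by (simp add: \<phi>_def add slot)
  qed
  have \<phi>_smult: "\<phi> (c \<odot>\<^bsub>Y\<^esub> y) = (\<lambda>n. c * \<phi> y n)" if "y \<in> carrier Y" for c y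
  proof
    fix n
    have "slot n (c \<odot>\<^bsub>Y\<^esub> y) = c \<odot>\<^bsub>sequence_module Y\<^esub> slot n y"
      by (auto simp: V_simps slot_def fun_eq_iff)
    then show "\<phi> (c \<odot>\<^bsub>Y\<^esub> y) n = c * \<phi> y n" using that by (simp add: \<phi>_def smult slot)
  qed
  have \<Phi>_combine: "\<Phi> (\<lambda>n. if n \<in> A then c n \<odot>\<^bsub>Y\<^esub> y else \<zero>\<^bsub>Y\<^esub>) = (\<Sum>n\<in>A. \<phi> y n * c n)"
    if "finite A" "y \<in> carrier Y" for A y c
    using that(1)
  proof (induction rule: finite_induct)
    case empty
    then show ?case using trace TI [of "\<lambda>_ _. 0"] by (simp add: I_zero)
  next
    case (insert k A)
    let ?w = "\<lambda>A n. if n \<in> A then c n \<odot>\<^bsub>Y\<^esub> y else \<zero>\<^bsub>Y\<^esub>"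
    have "?w (insert k A) = slot k (c k \<odot>\<^bsub>Y\<^esub> y) \<oplus>\<^bsub>sequence_module Y\<^esub> ?w A"
      using insert.hyps that by (auto simp: V_simps slot_def fun_eq_iff)
    moreover have "\<Phi> (slot k (c k \<odot>\<^bsub>Y\<^esub> y)) = c k * \<phi> y k"
      using fun_cong [OF \<phi>_smult, of y "c k" k] that by (simp add: \<phi>_def)
    moreover have "?w A \<in> carrier (sequence_module Y)" using that by (simp add: V_simps)
    ultimately show ?case
      using insert that slot [of "c k \<odot>\<^bsub>Y\<^esub> y" k] by (simp add: add mult.commute)
  qed
  have bound: "cmod (gpoly (\<phi> y) x) \<le> kernel_norm * nrm Y y" if y: "y \<in> carrier Y" for x y
  proof -
    let ?w = "\<lambda>n. if n \<in> J then h n x \<odot>\<^bsub>Y\<^esub> y else \<zero>\<^bsub>Y\<^esub>"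
    have "cmod (gpoly (\<phi> y) x) = cmod (\<Phi> ?w)"
      using \<Phi>_combine [OF finite_J y] by (simp add: gpoly_def)
    also have "\<dots> \<le> averaged_seminorm ?w" using y by (intro le) (simp add: V_simps)
    also have "\<dots> = averaged_seminorm (\<lambda>n. h n x \<odot>\<^bsub>Y\<^esub> y)"
      unfolding averaged_seminorm_def
      using y by (intro Bochner_Integration.integral_cong refl arg_cong [of _ _ "nrm Y"] finsum_cong') auto
    finally show ?thesis using averaged_seminorm_point [OF y] by simp
  qed
  define P where "P y = I (dpoly (\<phi> y))" for y
  have P_le: "nrm Y (P y) \<le> kernel_norm * nrm Y y" if "y \<in> carrier Y" for y
    unfolding P_def I_nrm by (rule nrm_dpoly_least) (rule bound [OF that])
  have P_id: "P (I (dpoly a)) = I (dpoly a)" for a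
  proof -
    have "\<phi> (I (dpoly a)) n = a n" if n: "n \<in> J" for n
    proof -
      have "slot n (I (dpoly a)) = (\<lambda>k. I (dpoly (\<lambda>j. if k = n then a j else 0)))"
        by (auto simp: slot_def I_zero fun_eq_iff)
      then have "\<phi> (I (dpoly a)) n = (\<Sum>k\<in>J. if k = n then a k else 0)"
        unfolding \<phi>_def using trace TI [of "\<lambda>k j. if k = n then a j else 0"] by simp
      then show ?thesis using n finite_J by (simp add: sum.delta)
    qed
    then have "dpoly (\<phi> (I (dpoly a))) = dpoly a" by (simp add: dpoly_def)
    then show ?thesis by (simp add: P_def)
  qed
  have "is_projection (I ` carrier X) Y P"
    unfolding is_projection_def bounded_linear_map_def linear_map_def
  proof (intro conjI ballI allI)
    show "\<exists>C. \<forall>y\<in>carrier Y. nrm Y (P y) \<le> C * nrm Y y" using P_le by blast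
    show "P x = x" if "x \<in> I ` carrier X" for x using that P_id by (auto simp: carrier_X)
    show "P (x \<oplus>\<^bsub>Y\<^esub> y) = P x \<oplus>\<^bsub>Y\<^esub> P y" if "x \<in> carrier Y" "y \<in> carrier Y" for x y
      using that by (simp add: P_def \<phi>_add I_add)
    show "P (c \<odot>\<^bsub>Y\<^esub> x) = c \<odot>\<^bsub>Y\<^esub> P x" if "x \<in> carrier Y" for c x
      using that by (simp add: P_def \<phi>_smult I_smult)
  qed (auto simp: P_def)
  moreover have "op_norm Y Y P \<le> ennreal kernel_norm"
    unfolding op_norm_def
  proof (rule SUP_least, rule ennreal_leI)
    fix y assume y: "y \<in> {y \<in> carrier Y. nrm Y y \<le> 1}"
    have "0 \<le> kernel_norm" unfolding kernel_norm_def by (rule Bochner_Integration.integral_nonneg) simp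
    then have "kernel_norm * nrm Y y \<le> kernel_norm * 1" using y by (intro mult_left_mono) auto
    then show "nrm Y (P y) \<le> kernel_norm" using P_le [of y] y by simp
  qed
  ultimately show ?thesis by blast
qed

end

section \<open>The lower bound\<close>

text \<open>
  Bounded continuous functions on \<open>\<complex>\<close> with the supremum norm, as elements of the left summand of the
  type. Any translation invariant Banach space of functions with this norm that contains the
  trigonometric polynomials would do as the superspace; this one inherits completeness from
  \<^typ>\<open>complex \<Rightarrow>\<^sub>C complex\<close>.
\<close>

definition bounded_continuous_module :: "((complex \<Rightarrow> complex) + 'y) normed_module" where
  "bounded_continuous_module =
     \<lparr>carrier = Inl ` bcontfun, mult = (\<lambda>a b. a), one = Inl (\<lambda>s. 1),
      zero = Inl (\<lambda>s. 0), add = (\<lambda>a b. Inl (\<lambda>s. projl a s + projl b s)),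
      smult = (\<lambda>c a. Inl (\<lambda>s. c * projl a s)), nrm = (\<lambda>a. SUP s. cmod (projl a s))\<rparr>"

lemma bounded_continuous_module_simps [simp]:
  "carrier bounded_continuous_module = Inl ` bcontfun"
  "zero bounded_continuous_module = Inl (\<lambda>s. 0)"
  "Inl F \<oplus>\<^bsub>bounded_continuous_module\<^esub> Inl G = Inl (\<lambda>s. F s + G s)"
  "c \<odot>\<^bsub>bounded_continuous_module\<^esub> Inl F = Inl (\<lambda>s. c * F s)"
  "nrm bounded_continuous_module (Inl F) = (SUP s. cmod (F s))"
  by (simp_all add: bounded_continuous_module_def)

lemma bcontfun_bdd: "F \<in> bcontfun \<Longrightarrow> bdd_above (range (\<lambda>s. cmod (F s)))"
  unfolding bcontfun_def bounded_iff by (auto simp: bdd_above_def)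

lemma bcontfun_addI: "F \<in> bcontfun \<Longrightarrow> G \<in> bcontfun \<Longrightarrow> (\<lambda>s. F s + G s :: complex) \<in> bcontfun"
  unfolding bcontfun_def by (auto intro!: continuous_intros bounded_plus_comp)

lemma bcontfun_multI: "F \<in> bcontfun \<Longrightarrow> (\<lambda>s. c * F s :: complex) \<in> bcontfun"
proof -
  assume F: "F \<in> bcontfun"
  then obtain B where "\<And>s. cmod (F s) \<le> B" by (auto simp: bcontfun_def bounded_iff)
  then have "cmod (c * F s) \<le> cmod c * B" for s by (simp add: norm_mult mult_left_mono)
  then show ?thesis using F by (auto simp: bcontfun_def bounded_iff intro!: continuous_intros)
qed

lemma bcontfun_zero: "(\<lambda>s. 0 :: complex) \<in> bcontfun"
  by (simp add: bcontfun_def)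

lemma complex_module_bounded_continuous: "complex_module bounded_continuous_module"
proof (intro complex_module.intro Module.moduleI complex_ring_cring abelian_groupI)
  fix x :: "(complex \<Rightarrow> complex) + 'y" assume "x \<in> carrier bounded_continuous_module"
  then obtain F where F: "x = Inl F" "F \<in> bcontfun" by auto
  show "\<exists>y\<in>carrier bounded_continuous_module. y \<oplus>\<^bsub>bounded_continuous_module\<^esub> x = \<zero>\<^bsub>bounded_continuous_module\<^esub>"
    using F bcontfun_multI [OF F(2), of "-1"] by (intro bexI [of _ "Inl (\<lambda>s. - 1 * F s)"]) auto
qed (auto simp: algebra_simps intro!: imageI bcontfun_addI bcontfun_multI bcontfun_zero)

lemma complex_banach_bounded_continuous:
  "complex_banach_space (bounded_continuous_module :: ((complex \<Rightarrow> complex) + 'y) normed_module)"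
proof -
  let ?B = "bounded_continuous_module :: ((complex \<Rightarrow> complex) + 'y) normed_module"
  interpret B: complex_module ?B by (rule complex_module_bounded_continuous)
  have upper: "cmod (F s) \<le> (SUP s. cmod (F s))" if "F \<in> bcontfun" for F s
    by (rule cSUP_upper [OF UNIV_I bcontfun_bdd [OF that]])
  have minus: "Inl F \<ominus>\<^bsub>?B\<^esub> Inl G = Inl (\<lambda>s. F s - G s)" if "F \<in> bcontfun" "G \<in> bcontfun" for F G
    using that by (simp add: B.minus_eq B.minus_eq_smult)
  show ?thesis
  proof (unfold_locales)
    fix x assume "x \<in> carrier ?B"
    then obtain F where F: "x = Inl F" "F \<in> bcontfun" by auto
    have nn: "0 \<le> (SUP s. cmod (F s))" using upper [OF F(2), of 0] by (rule order_trans [OF norm_ge_zero])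
    then show "0 \<le> nrm ?B x" using F by simp
    show "nrm ?B x = 0 \<longleftrightarrow> x = \<zero>\<^bsub>?B\<^esub>"
      using F upper [OF F(2)] by (auto simp: fun_eq_iff)
    show "nrm ?B (c \<odot>\<^bsub>?B\<^esub> x) = cmod c * nrm ?B x" for c
    proof (cases "c = 0")
      case True
      then show ?thesis using F by simp
    next
      case False
      have "(SUP s. cmod c * cmod (F s)) = cmod c * (SUP s. cmod (F s))"
      proof (rule antisym)
        show "(SUP s. cmod c * cmod (F s)) \<le> cmod c * (SUP s. cmod (F s))"
          using upper [OF F(2)] by (intro cSUP_least mult_left_mono) auto
        have "cmod (F s) \<le> (SUP s. cmod c * cmod (F s)) / cmod c" for s
          using upper [OF bcontfun_multI [OF F(2)], of c s] False by (simp add: norm_mult field_simps)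
        then have "(SUP s. cmod (F s)) \<le> (SUP s. cmod c * cmod (F s)) / cmod c"
          by (intro cSUP_least) auto
        then show "cmod c * (SUP s. cmod (F s)) \<le> (SUP s. cmod c * cmod (F s))"
          using False by (simp add: field_simps)
      qed
      then show ?thesis using F by (simp add: norm_mult)
    qed
    fix y assume "y \<in> carrier ?B"
    then obtain G where G: "y = Inl G" "G \<in> bcontfun" by auto
    show "nrm ?B (x \<oplus>\<^bsub>?B\<^esub> y) \<le> nrm ?B x + nrm ?B y"
      using F G by (auto intro!: cSUP_least order_trans [OF norm_triangle_ineq] add_mono upper)
  next
    fix \<sigma> :: "nat \<Rightarrow> (complex \<Rightarrow> complex) + 'y"
    assume \<sigma>: "\<And>n. \<sigma> n \<in> carrier ?B"
      and Cauchy: "\<And>e. e > 0 \<Longrightarrow> \<exists>N. \<forall>m\<ge>N. \<forall>n\<ge>N. nrm ?B (\<sigma> m \<ominus>\<^bsub>?B\<^esub> \<sigma> n) < e"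
    define f where "f n = Bcontfun (projl (\<sigma> n))" for n
    have \<sigma>_f: "\<sigma> n = Inl (apply_bcontfun (f n))" for n
      using \<sigma> [of n] by (auto simp: f_def Bcontfun_inverse)
    have dist: "nrm ?B (Inl (apply_bcontfun a) \<ominus>\<^bsub>?B\<^esub> Inl (apply_bcontfun b)) = dist a b"
      for a b :: "complex \<Rightarrow>\<^sub>C complex"
      by (simp add: minus [OF apply_bcontfun apply_bcontfun] dist_bcontfun.rep_eq dist_norm)
    have "Cauchy f"
      unfolding Cauchy_def using Cauchy unfolding \<sigma>_f dist by blast
    then obtain l where "f \<longlonglongrightarrow> l" by (auto simp: Cauchy_convergent_iff convergent_def)
    then have "(\<lambda>n. nrm ?B (\<sigma> n \<ominus>\<^bsub>?B\<^esub> Inl (apply_bcontfun l))) \<longlonglongrightarrow> 0"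
      unfolding \<sigma>_f dist by (rule iffD1 [OF tendsto_dist_iff])
    then show "\<exists>l\<in>carrier ?B. (\<lambda>n. nrm ?B (\<sigma> n \<ominus>\<^bsub>?B\<^esub> l)) \<longlonglongrightarrow> 0"
      by (rule bexI) (simp only: bounded_continuous_module_simps, rule imageI, rule apply_bcontfun)
  qed
qed

context dirichlet_haar
begin

abbreviation "\<B> \<equiv> bounded_continuous_module"

text \<open>
  Functions on the group and Dirichlet polynomials both become functions on \<open>\<complex>\<close> that depend on the
  imaginary part only.
\<close>

definition lift :: "('g \<Rightarrow> complex) \<Rightarrow> (complex \<Rightarrow> complex) + 'y" where
  "lift F = Inl (\<lambda>s. F (\<beta> (Im s)))"

definition line_embedding :: "(complex \<Rightarrow> complex) \<Rightarrow> (complex \<Rightarrow> complex) + 'y" where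
  "line_embedding D = Inl (\<lambda>s. D (\<i> * of_real (Im s)))"

lemma line_embedding_dpoly: "line_embedding (dpoly a) = lift (gpoly a)"
  by (simp add: line_embedding_def lift_def dpoly_gpoly)

lemma continuous_bounded: "continuous_on UNIV F \<Longrightarrow> bounded (range (F :: 'g \<Rightarrow> complex))"
  using compact_continuous_image [OF _ compact_G] compact_imp_bounded by blast

lemma lift_in: "continuous_on UNIV F \<Longrightarrow> lift F \<in> carrier \<B>"
proof -
  assume F: "continuous_on UNIV F"
  have "continuous_on UNIV (\<lambda>s. F (\<beta> (Im s)))"
    by (intro continuous_on_compose2 [OF F] continuous_on_compose2 [OF \<beta>_cont] continuous_intros) auto
  moreover have "bounded (range (\<lambda>s. F (\<beta> (Im s))))"
    by (rule bounded_subset [OF continuous_bounded [OF F]]) auto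
  ultimately show ?thesis by (simp add: lift_def bcontfun_def)
qed

lemma line_embedding_isometric: "isometric_embedding X \<B> line_embedding"
proof -
  have "nrm \<B> (line_embedding (dpoly a)) = nrm X (dpoly a)" for a
  proof -
    have "range (\<lambda>s. cmod (gpoly a (\<beta> (Im s)))) = range (\<lambda>t. cmod (gpoly a (\<beta> t)))"
    proof -
      have "surj Im" by (rule surjI [of _ "Complex 0"]) simp
      then show ?thesis using image_image [of "\<lambda>t. cmod (gpoly a (\<beta> t))" Im UNIV] by simp
    qed
    then show ?thesis
      by (simp add: line_embedding_dpoly lift_def nrm_X dpoly_gpoly)
  qed
  moreover have "line_embedding (dpoly a) \<in> carrier \<B>" for a
    unfolding line_embedding_dpoly by (intro lift_in continuous_intros)
  ultimately show ?thesis
    unfolding isometric_embedding_def linear_map_def carrier_X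
    by (auto simp: dpoly_add dpoly_smult) 
      (auto simp: line_embedding_def dpoly_def algebra_simps sum.distrib sum_distrib_left)
qed

lemma gpoly_coefficient:
  assumes "n \<in> J" shows "(\<integral>x. gpoly a x * cnj (h n x) \<partial>m) = a n"
proof -
  have "(\<integral>x. gpoly a x * cnj (h n x) \<partial>m) = (\<integral>x. (\<Sum>k\<in>J. a k * (h k x * cnj (h n x))) \<partial>m)"
    by (simp add: gpoly_def sum_distrib_left sum_distrib_right mult_ac)
  also have "\<dots> = (\<Sum>k\<in>J. a k * (if k = n then 1 else 0))"
    unfolding h_orthonormal [symmetric]
    by (subst Bochner_Integration.integral_sum, intro continuous_integrable continuous_intros, simp)
  also have "\<dots> = a n"
    using assms finite_J by (simp add: if_distrib [of "(*) _"] sum.delta cong: if_cong)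
  finally show ?thesis .
qed

lemma lift_inj:
  assumes "continuous_on UNIV F" "continuous_on UNIV G"
    and eq: "(lift F :: (complex \<Rightarrow> complex) + 'y) = lift G"
  shows "F = G"
proof
  fix x
  have "F (\<beta> t) = G (\<beta> t)" for t
    using fun_cong [of "\<lambda>s. F (\<beta> (Im s))" "\<lambda>s. G (\<beta> (Im s))" "Complex 0 t"] eq by (simp add: lift_def)
  then have "cmod (F x - G x) \<le> 0"
    using bound_by_density [of "\<lambda>x. F x - G x" 0 x] continuous_on_diff [OF assms(1,2)] by simp
  then show "F x = G x" by simp
qed

text \<open>
  Averaging \<open>T\<^sub>-\<^sub>g P T\<^sub>g\<close> over the translations \<open>T\<^sub>g\<close> turns any projection \<open>P\<close> into convolution with the
  kernel. Only the value at the origin of the averaged function is needed, which for a trigonometric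
  polynomial is the integral of a scalar function \<open>k\<close>. The claim is linear in \<open>F\<close>, so it
  suffices to treat a character \<open>\<phi>\<close>. There \<open>T\<^sub>g \<phi> = \<phi> g \<phi>\<close>, and \<open>k g\<close> is \<open>\<phi> g\<close> times the value of
  \<open>P \<phi>\<close> at \<open>-g\<close>; by orthogonality its integral vanishes unless \<open>\<phi>\<close> is one of the \<open>h n\<close>, and those are
  fixed by \<open>P\<close>.
\<close>

lemma projection_translation_average:
  fixes P :: "(complex \<Rightarrow> complex) + 'y \<Rightarrow> (complex \<Rightarrow> complex) + 'y"
  assumes P: "is_projection (line_embedding ` carrier X) \<B> P" and F: "trig_polynomial F"
  shows "\<exists>k. continuous_on UNIV k
          \<and> (\<forall>t. k (\<beta> t) = projl (P (lift (\<lambda>x. F (x + \<beta> t)))) (Complex 0 (- t)))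
          \<and> (\<integral>x. k x \<partial>m) = (\<integral>x. F x * cnj (kernel x) \<partial>m)"
proof -
  have Padd: "P (x \<oplus>\<^bsub>\<B>\<^esub> y) = P x \<oplus>\<^bsub>\<B>\<^esub> P y" if "x \<in> carrier \<B>" "y \<in> carrier \<B>" for x y
    using P that unfolding is_projection_def bounded_linear_map_def linear_map_def by blast
  have Psmult: "P (c \<odot>\<^bsub>\<B>\<^esub> x) = c \<odot>\<^bsub>\<B>\<^esub> P x" if "x \<in> carrier \<B>" for c x
    using P that unfolding is_projection_def bounded_linear_map_def linear_map_def by blast
  have Prange: "\<exists>a. P x = lift (gpoly a)" if "x \<in> carrier \<B>" for x
  proof -
    have "P x \<in> line_embedding ` carrier X" using P that unfolding is_projection_def by blast
    then show ?thesis by (auto simp: carrier_X line_embedding_dpoly)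
  qed
  have Pid: "P (lift (gpoly a)) = lift (gpoly a)" for a
  proof -
    have "lift (gpoly a) \<in> line_embedding ` carrier X"
      unfolding line_embedding_dpoly [symmetric] by (intro imageI dpoly_in)
    then show ?thesis using P unfolding is_projection_def by blast
  qed
  from F show ?thesis
  proof (induction rule: trig_polynomial.induct)
    case zero
    have "P (lift (\<lambda>x. 0)) = 0 \<odot>\<^bsub>\<B>\<^esub> P (lift (\<lambda>x. 0))"
      using Psmult [of "lift (\<lambda>x. 0)" 0] lift_in [of "\<lambda>x. 0"] by (simp add: lift_def)
    also have "\<dots> = Inl (\<lambda>s. 0)"
      using Prange [of "lift (\<lambda>x. 0)"] lift_in [of "\<lambda>x. 0"] by (auto simp: lift_def)
    finally show ?case by (intro exI [of _ "\<lambda>x. 0"]) simp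
  next
    case (add \<phi> F c)
    note \<phi> = add.hyps(1)
    have F_cont: "continuous_on UNIV F" by (rule trig_polynomial_continuous [OF add.hyps(2)])
    from add.IH obtain k where k: "continuous_on UNIV k"
      "\<And>t. k (\<beta> t) = projl (P (lift (\<lambda>x. F (x + \<beta> t)))) (Complex 0 (- t))"
      "(\<integral>x. k x \<partial>m) = (\<integral>x. F x * cnj (kernel x) \<partial>m)" by blast
    have \<phi>_cont: "continuous_on UNIV \<phi>" by (rule continuous_characterD(1) [OF \<phi>])
    obtain a where a: "P (lift \<phi>) = lift (gpoly a)" using Prange [OF lift_in [OF \<phi>_cont]] by blast
    \<comment> \<open>Either \<open>\<phi> = h n\<close> and \<open>P\<close> fixes \<open>\<phi>\<close>, so that \<open>a n = 1\<close>, or the integral vanishes.\<close>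
    have a_eq: "a n * (\<integral>x. \<phi> x * cnj (h n x) \<partial>m) = (\<integral>x. \<phi> x * cnj (h n x) \<partial>m)"
      if n: "n \<in> J" for n
    proof (cases "\<phi> = h n")
      case True
      have hn: "h n = gpoly (\<lambda>k. if k = n then 1 else 0)"
        using n finite_J by (auto simp: gpoly_def fun_eq_iff if_distrib [of "\<lambda>x. x * _"] sum.delta cong: if_cong)
      have "gpoly a = h n"
      proof (rule lift_inj)
        show "(lift (gpoly a) :: (complex \<Rightarrow> complex) + 'y) = lift (h n)"
          using a True Pid hn by metis
      qed (intro continuous_intros)+
      then have "a n = 1"
        using gpoly_coefficient [OF n, of a] h_orthonormal [of n n] by simp
      then show ?thesis by simp
    next
      case False
      then show ?thesis using integral_character_orthogonal [OF \<phi> h_character] by simp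
    qed
    have neg: "gpoly a (- x) = (\<Sum>n\<in>J. a n * cnj (h n x))" for x
      by (simp add: gpoly_def continuous_character_minus [OF h_character])
    define k' where "k' x = c * \<phi> x * gpoly a (- x) + k x" for x
    have \<beta>_minus: "\<beta> (- t) = - \<beta> t" for t
    proof -
      have "\<beta> 0 = 0" using \<beta>_add [of 0 0] by simp
      then have "\<beta> (- t) + \<beta> t = 0" using \<beta>_add [of "- t" t] by simp
      then show ?thesis by (simp add: eq_neg_iff_add_eq_0)
    qed
    have "continuous_on UNIV k'"
      unfolding k'_def by (intro continuous_intros \<phi>_cont k)
    moreover have "k' (\<beta> t) = projl (P (lift (\<lambda>x. c * \<phi> (x + \<beta> t) + F (x + \<beta> t)))) (Complex 0 (- t))" for t
    proof -
      let ?Ft = "lift (\<lambda>x. F (x + \<beta> t)) :: (complex \<Rightarrow> complex) + 'y"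
      have Ft: "?Ft \<in> carrier \<B>"
        by (intro lift_in continuous_on_compose2 [OF F_cont] continuous_intros) auto
      have "lift (\<lambda>x. c * \<phi> (x + \<beta> t) + F (x + \<beta> t)) = (c * \<phi> (\<beta> t)) \<odot>\<^bsub>\<B>\<^esub> lift \<phi> \<oplus>\<^bsub>\<B>\<^esub> ?Ft"
        by (simp add: lift_def continuous_characterD(3) [OF \<phi>] mult_ac)
      also have "P \<dots> = (c * \<phi> (\<beta> t)) \<odot>\<^bsub>\<B>\<^esub> P (lift \<phi>) \<oplus>\<^bsub>\<B>\<^esub> P ?Ft"
      proof -
        have "(c * \<phi> (\<beta> t)) \<odot>\<^bsub>\<B>\<^esub> (lift \<phi> :: (complex \<Rightarrow> complex) + 'y) \<in> carrier \<B>"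
          using lift_in [of "\<lambda>x. c * \<phi> (\<beta> t) * \<phi> x"] \<phi>_cont
          by (simp add: lift_def continuous_on_mult_left)
        then show ?thesis using Ft by (simp only: Padd Psmult lift_in [OF \<phi>_cont])
      qed
      also obtain b where b: "P ?Ft = lift (gpoly b)" using Prange [OF Ft] by blast
      also have "(c * \<phi> (\<beta> t)) \<odot>\<^bsub>\<B>\<^esub> P (lift \<phi>) \<oplus>\<^bsub>\<B>\<^esub> lift (gpoly b)
          = Inl (\<lambda>s. c * \<phi> (\<beta> t) * gpoly a (\<beta> (Im s)) + gpoly b (\<beta> (Im s)))"
        unfolding a by (simp add: lift_def)
      finally have "projl (P (lift (\<lambda>x. c * \<phi> (x + \<beta> t) + F (x + \<beta> t)))) (Complex 0 (- t))
          = c * \<phi> (\<beta> t) * gpoly a (\<beta> (- t)) + projl (P ?Ft) (Complex 0 (- t))"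
        unfolding b by (simp add: lift_def [of "gpoly b"])
      then show ?thesis by (simp add: k'_def k \<beta>_minus)
    qed
    moreover have "(\<integral>x. k' x \<partial>m) = (\<integral>x. (c * \<phi> x + F x) * cnj (kernel x) \<partial>m)"
    proof -
      have int: "(\<integral>x. (\<Sum>n\<in>J. b n * (\<phi> x * cnj (h n x))) \<partial>m) = (\<Sum>n\<in>J. b n * (\<integral>x. \<phi> x * cnj (h n x) \<partial>m))" for b
        by (subst Bochner_Integration.integral_sum)
           (intro continuous_integrable continuous_intros \<phi>_cont, simp)
      have "(\<integral>x. k' x \<partial>m) = (\<integral>x. c * (\<phi> x * gpoly a (- x)) \<partial>m) + (\<integral>x. k x \<partial>m)"
        unfolding k'_def mult.assoc
        by (intro Bochner_Integration.integral_add continuous_integrable continuous_intros \<phi>_cont k)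
      also have "(\<integral>x. c * (\<phi> x * gpoly a (- x)) \<partial>m) = c * (\<integral>x. \<phi> x * gpoly a (- x) \<partial>m)" by simp
      also have "(\<integral>x. \<phi> x * gpoly a (- x) \<partial>m) = (\<integral>x. (\<Sum>n\<in>J. a n * (\<phi> x * cnj (h n x))) \<partial>m)"
        by (simp add: neg sum_distrib_left mult_ac)
      also have "\<dots> = (\<integral>x. (\<Sum>n\<in>J. 1 * (\<phi> x * cnj (h n x))) \<partial>m)"
        unfolding int by (rule sum.cong [OF refl]) (simp only: a_eq mult_1)
      also have "\<dots> = (\<integral>x. \<phi> x * cnj (kernel x) \<partial>m)"
        by (simp add: kernel_def sum_distrib_left)
      also have "c * \<dots> = (\<integral>x. c * (\<phi> x * cnj (kernel x)) \<partial>m)" by simp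
      also have "(\<integral>x. c * (\<phi> x * cnj (kernel x)) \<partial>m) + (\<integral>x. k x \<partial>m)
          = (\<integral>x. c * (\<phi> x * cnj (kernel x)) + F x * cnj (kernel x) \<partial>m)"
        unfolding k(3)
        by (intro Bochner_Integration.integral_add [symmetric] continuous_integrable continuous_intros
            \<phi>_cont F_cont)
      finally show ?thesis by (simp add: algebra_simps)
    qed
    ultimately show ?case by blast
  qed
qed

text \<open>
  At \<open>\<beta> t\<close> the function \<open>k\<close> of \<open>projection_translation_average\<close> is a value of the image under \<open>P\<close> of
  a translate of \<open>F\<close>, hence bounded by the norm of \<open>P\<close>; density transfers the bound to the whole group.
\<close>

lemma projection_functional_bound:
  fixes P :: "(complex \<Rightarrow> complex) + 'y \<Rightarrow> (complex \<Rightarrow> complex) + 'y"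
  assumes P: "is_projection (line_embedding ` carrier X) \<B> P"
    and K: "op_norm \<B> \<B> P \<le> ennreal K" "0 \<le> K"
    and F: "trig_polynomial F" "\<And>x. cmod (F x) \<le> 1"
  shows "cmod (\<integral>x. F x * cnj (kernel x) \<partial>m) \<le> K"
proof -
  obtain k where k: "continuous_on UNIV k"
      "\<And>t. k (\<beta> t) = projl (P (lift (\<lambda>x. F (x + \<beta> t)))) (Complex 0 (- t))"
      "(\<integral>x. k x \<partial>m) = (\<integral>x. F x * cnj (kernel x) \<partial>m)"
    using projection_translation_average [OF P F(1)] by blast
  have "cmod (k x) \<le> K" for x
  proof (rule bound_by_density [OF k(1)])
    fix t
    let ?f = "lift (\<lambda>x. F (x + \<beta> t)) :: (complex \<Rightarrow> complex) + 'y"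
    have f: "?f \<in> carrier \<B>"
      by (intro lift_in continuous_on_compose2 [OF trig_polynomial_continuous [OF F(1)]] continuous_intros) auto
    have "P ?f \<in> carrier \<B>"
      using P f unfolding is_projection_def bounded_linear_map_def linear_map_def by blast
    then obtain G where G: "P ?f = Inl G" "G \<in> bcontfun" by auto
    have "cmod (k (\<beta> t)) \<le> nrm \<B> (P ?f)"
      using cSUP_upper [OF UNIV_I bcontfun_bdd [OF G(2)]] by (simp add: k(2) G(1))
    moreover have "nrm \<B> ?f \<le> 1"
      using F(2) by (auto simp: lift_def intro!: cSUP_least)
    then have "ennreal (nrm \<B> (P ?f)) \<le> op_norm \<B> \<B> P"
      unfolding op_norm_def using f by (intro SUP_upper) auto
    then have "nrm \<B> (P ?f) \<le> K" using K by (meson ennreal_le_iff order_trans)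
    ultimately show "cmod (k (\<beta> t)) \<le> K" by linarith
  qed
  then have "(\<integral>x. cmod (k x) \<partial>m) \<le> (\<integral>x. K \<partial>m)"
    by (intro integral_mono_continuous continuous_intros k)
  moreover have "norm (\<integral>x. k x \<partial>m) \<le> (\<integral>x. cmod (k x) \<partial>m)" by (rule integral_norm_bound)
  ultimately show ?thesis unfolding k(3) integral_const by linarith
qed

lemma kernel_bound: "cmod (kernel x) \<le> card J"
  unfolding kernel_def
  using sum_norm_le [of J "\<lambda>n. h n x" "\<lambda>n. 1"] by (simp add: continuous_characterD(2) [OF h_character])

text \<open>
  The integral of \<open>F\<close> times the conjugate kernel would be the \<open>L\<^sup>1\<close> norm for the sign
  \<open>F = kernel / \<bar>kernel\<bar>\<close>, which in general is not a trigonometric polynomial. Replacing \<open>1 / \<bar>kernel\<bar>\<close> by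
  \<open>1 / max \<bar>kernel\<bar> e\<close> costs at most \<open>e\<close>. The latter is a continuous function of
  \<open>\<bar>kernel\<bar>\<^sup>2 = kernel * cnj kernel\<close>, so it is uniformly approximable by a polynomial \<open>q\<close> in this
  trigonometric polynomial.
\<close>

lemma kernel_sign_approximation:
  fixes e :: real
  assumes e: "0 < e"
  shows "\<exists>F. trig_polynomial F \<and> (\<forall>x. cmod (F x) \<le> 1) \<and>
    kernel_norm \<le> (1 + card J * e) * cmod (\<integral>x. F x * cnj (kernel x) \<partial>m) + e + (real (card J))\<^sup>2 * e"
proof -
  define N where "N = real (card J)"
  have N: "0 \<le> N" "cmod (kernel x) \<le> N" for x by (simp_all add: N_def kernel_bound)
  obtain q where q: "real_polynomial_function q"
    "\<And>u. u \<in> {0..N\<^sup>2} \<Longrightarrow> \<bar>1 / max (sqrt u) e - q u\<bar> < e"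
  proof (rule Stone_Weierstrass_real_polynomial_function [of "{0..N\<^sup>2}" "\<lambda>u. 1 / max (sqrt u) e" e])
    show "continuous_on {0..N\<^sup>2} (\<lambda>u. 1 / max (sqrt u) e)"
      using e by (intro continuous_intros) (auto simp: max_def)
  qed (use e in auto)
  define r where "r x = cmod (kernel x)" for x
  have r: "0 \<le> r x" "r x \<le> N" for x using N by (auto simp: r_def)
  have r2: "kernel x * cnj (kernel x) = of_real ((r x)\<^sup>2)" for x
    unfolding r_def by (rule complex_norm_square [symmetric])
  have qr: "\<bar>1 / max (r x) e - q ((r x)\<^sup>2)\<bar> < e" for x
    using q(2) [of "(r x)\<^sup>2"] r [of x] by (simp add: power_mono)
  \<comment> \<open>The supremum norm of \<open>kernel * q\<close> exceeds \<open>1\<close> by at most \<open>N * e\<close>.\<close>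
  define d where "d = 1 + N * e"
  have d: "d > 0" using e N by (simp add: d_def add_pos_nonneg)
  define F where "F x = of_real (1 / d) * (kernel x * of_real (q ((r x)\<^sup>2)))" for x
  have kernel_trig: "trig_polynomial kernel"
    unfolding kernel_def [abs_def]
    using trig_polynomial_sum [of J h] trig_polynomial_character [OF h_character, of 1] by simp
  have F_trig: "trig_polynomial F"
  proof -
    have "trig_polynomial (\<lambda>x. of_real ((r x)\<^sup>2))"
      unfolding r2 [symmetric] by (rule trig_polynomial_mult [OF kernel_trig trig_polynomial_cnj [OF kernel_trig]])
    then have "trig_polynomial (\<lambda>x. of_real (q ((r x)\<^sup>2)))"
      by (rule trig_polynomial_real_polynomial [OF q(1)])
    then show ?thesis
      unfolding F_def [abs_def] by (intro trig_polynomial_mult trig_polynomial_const kernel_trig)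
  qed
  have F_le: "cmod (F x) \<le> 1" for x
  proof -
    have "\<bar>q ((r x)\<^sup>2)\<bar> \<le> 1 / max (r x) e + e" using qr [of x] e
      by (smt (verit) divide_nonneg_pos)
    then have "r x * \<bar>q ((r x)\<^sup>2)\<bar> \<le> r x * (1 / max (r x) e + e)" using r by (intro mult_left_mono) auto
    also have "\<dots> = r x / max (r x) e + r x * e" by (simp add: algebra_simps)
    also have "\<dots> \<le> 1 + N * e"
      using e r by (intro add_mono mult_right_mono) (auto simp: divide_le_eq max_def)
    finally have "r x * \<bar>q ((r x)\<^sup>2)\<bar> \<le> d" by (simp add: d_def)
    then show ?thesis using d by (simp add: F_def norm_mult norm_divide r_def [symmetric] divide_le_eq)
  qed
  let ?R = "\<lambda>x. (r x)\<^sup>2 * q ((r x)\<^sup>2) / d"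
  have FR: "F x * cnj (kernel x) = of_real (?R x)" for x
    using r2 [of x] by (simp add: F_def mult_ac)
  have F_cont: "continuous_on UNIV F" by (rule trig_polynomial_continuous [OF F_trig])
  have R_cont: "continuous_on UNIV ?R"
  proof -
    have "continuous_on UNIV (\<lambda>x. Re (F x * cnj (kernel x)))" by (intro continuous_intros F_cont)
    then show ?thesis unfolding FR by simp
  qed
  have "r x - (e + N\<^sup>2 * e) \<le> d * ?R x" for x
  proof -
    have "(r x)\<^sup>2 / max (r x) e \<ge> r x - e"
    proof (cases "r x \<le> e")
      case True
      then show ?thesis using e by (simp add: max_def) (smt (verit) divide_nonneg_pos zero_le_power2)
    next
      case False
      then show ?thesis using e by (simp add: max_def power2_eq_square)
    qed
    moreover have "(r x)\<^sup>2 * (1 / max (r x) e - q ((r x)\<^sup>2)) \<le> N\<^sup>2 * e"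
    proof -
      have "(r x)\<^sup>2 * (1 / max (r x) e - q ((r x)\<^sup>2)) \<le> (r x)\<^sup>2 * e"
        using qr [of x] by (intro mult_left_mono) auto
      also have "\<dots> \<le> N\<^sup>2 * e" using r [of x] e by (intro mult_right_mono power_mono) auto
      finally show ?thesis .
    qed
    ultimately show ?thesis using d by (simp add: algebra_simps)
  qed
  then have "(\<integral>x. r x - (e + N\<^sup>2 * e) \<partial>m) \<le> (\<integral>x. d * ?R x \<partial>m)"
    by (intro integral_mono_continuous continuous_on_mult_left R_cont)
       (auto simp: r_def intro!: continuous_intros)
  also have "(\<integral>x. d * ?R x \<partial>m) = d * (\<integral>x. ?R x \<partial>m)" by (rule integral_mult_right_zero)
  also have "(\<integral>x. ?R x \<partial>m) \<le> cmod (\<integral>x. F x * cnj (kernel x) \<partial>m)"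
    unfolding FR integral_complex_of_real norm_of_real by (rule abs_ge_self)
  also have "(\<integral>x. r x - (e + N\<^sup>2 * e) \<partial>m) = kernel_norm - (e + N\<^sup>2 * e)"
    unfolding kernel_norm_def r_def
    by (subst Bochner_Integration.integral_diff)
       (auto intro!: continuous_integrable continuous_intros simp: space_m measure_m)
  finally have "kernel_norm \<le> d * cmod (\<integral>x. F x * cnj (kernel x) \<partial>m) + e + N\<^sup>2 * e"
    using d by simp
  then show ?thesis using F_trig F_le unfolding d_def N_def by blast
qed

text \<open>
  Approximate signs of the kernel are tested against \<open>P\<close>, and the error \<open>e\<close> tends to \<open>0\<close>.
\<close>

lemma op_norm_ge_kernel_norm:
  fixes P :: "(complex \<Rightarrow> complex) + 'y \<Rightarrow> (complex \<Rightarrow> complex) + 'y"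
  assumes P: "is_projection (line_embedding ` carrier X) \<B> P"
  shows "ennreal kernel_norm \<le> op_norm \<B> \<B> P"
proof (cases "op_norm \<B> \<B> P")
  case (real K)
  define N where "N = real (card J)"
  \<comment> \<open>Collects all error terms: an approximation with error \<open>e\<close> loses at most \<open>e * c\<close>.\<close>
  define c where "c = 1 + N\<^sup>2 + N * K"
  have c: "c > 0" using real(1) by (simp add: c_def N_def add_pos_nonneg)
  have "kernel_norm \<le> K + \<epsilon>" if "\<epsilon> > 0" for \<epsilon>
  proof -
    define e where "e = \<epsilon> / c"
    have e: "e > 0" "e * c = \<epsilon>" using that c by (simp_all add: e_def)
    obtain F where F: "trig_polynomial F" "\<And>x. cmod (F x) \<le> 1"
      "kernel_norm \<le> (1 + N * e) * cmod (\<integral>x. F x * cnj (kernel x) \<partial>m) + e + N\<^sup>2 * e"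
      using kernel_sign_approximation [OF e(1)] unfolding N_def by blast
    have "(1 + N * e) * cmod (\<integral>x. F x * cnj (kernel x) \<partial>m) \<le> (1 + N * e) * K"
      using projection_functional_bound [OF P _ real(1) F(1,2)] real e
      by (intro mult_left_mono) (auto simp: N_def)
    moreover have "(1 + N * e) * K + e + N\<^sup>2 * e = K + e * c" by (simp add: c_def algebra_simps)
    ultimately show ?thesis using F(3) e(2) by linarith
  qed
  then have "kernel_norm \<le> K" by (rule field_le_epsilon)
  then show ?thesis using real by (simp add: ennreal_leI)
qed simp

end

section \<open>The projection constant\<close>

theorem theorem3p6:
  fixes J :: "nat set" and \<omega> :: "nat \<Rightarrow> real"
    and \<beta> :: "real \<Rightarrow> 'g :: {topological_ab_group_add, t2_space}"
    and m :: "'g measure"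
  assumes "finite J"
    and "frequency \<omega>"
    and "omega_dirichlet_group \<omega> \<beta>"
    and "normalized_haar_measure m"
  shows "projection_constant TYPE('y) (dirichlet_polynomials J \<omega>) =
           ennreal (\<integral>x. cmod (\<Sum>n\<in>J. frequency_character \<beta> (\<omega> n) x) \<partial>m)"
proof -
  interpret dirichlet_haar m J \<omega> \<beta>
  proof
    show "compact (UNIV :: 'g set)"
      using assms(3) by (simp add: omega_dirichlet_group_def dirichlet_group_def)
    show "inj \<omega>" using assms(2) by (simp add: frequency_def strict_mono_imp_inj_on)
  qed (use assms in auto)
  have upper: "\<exists>P. is_projection (I ` carrier X) Y P \<and> op_norm Y Y P \<le> ennreal kernel_norm"
    if "complex_banach_space Y" "isometric_embedding X Y I"
    for Y :: "((complex \<Rightarrow> complex) + 'y) normed_module" and I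
  proof -
    have "complex_normed_space Y" using that(1) by (simp add: complex_banach_space_def)
    then interpret dirichlet_embedding m J \<omega> \<beta> Y I
      by (intro dirichlet_embedding.intro dirichlet_embedding_axioms.intro dirichlet_haar_axioms that)
    show ?thesis by (rule projection_exists)
  qed
  have "projection_constant TYPE('y) X = ennreal kernel_norm"
  proof (rule antisym)
    show "projection_constant TYPE('y) X \<le> ennreal kernel_norm"
      unfolding projection_constant_def
    proof (rule SUP_least, clarify)
      fix Y :: "((complex \<Rightarrow> complex) + 'y) normed_module" and I
      assume "complex_banach_space Y" "isometric_embedding X Y I"
      from upper [OF this] obtain P where
        P: "is_projection (I ` carrier X) Y P" "op_norm Y Y P \<le> ennreal kernel_norm" by blast
      have "relative_projection_constant (I ` carrier X) Y \<le> op_norm Y Y P"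
        unfolding relative_projection_constant_def using P by (intro INF_lower) simp
      then show "relative_projection_constant (I ` carrier X) Y \<le> ennreal kernel_norm"
        using P(2) by (rule order_trans)
    qed
  next
    let ?I = "line_embedding :: _ \<Rightarrow> (complex \<Rightarrow> complex) + 'y"
    have "ennreal kernel_norm \<le> relative_projection_constant (?I ` carrier X) \<B>"
      unfolding relative_projection_constant_def by (rule INF_greatest) (simp add: op_norm_ge_kernel_norm)
    also have "\<dots> \<le> projection_constant TYPE('y) X"
    proof -
      have "complemented (?I ` carrier X) \<B>"
        unfolding complemented_def
        using upper [OF complex_banach_bounded_continuous line_embedding_isometric] by blast
      then have "(\<B>, ?I) \<in> {(Y, I). complex_banach_space Y \<and> isometric_embedding X Y I \<and>
                    complemented (I ` carrier X) Y}"
        using complex_banach_bounded_continuous line_embedding_isometric by simp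
      from SUP_upper [OF this, of "\<lambda>(Y, I). relative_projection_constant (I ` carrier X) Y"]
      show ?thesis unfolding projection_constant_def by simp
    qed
    finally show "ennreal kernel_norm \<le> projection_constant TYPE('y) X" .
  qed
  then show ?thesis by (simp add: kernel_norm_def kernel_def h_def)
qed

end
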